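(* Let $F$ be an algebraically closed field with $\mathrm{char}\,F\neq 2$ and let $G$ be an abelian group. Let $\mathcal{U}$ be a $G$-grading on $UT_m(F)$ and $\mathcal{U}'$ a $G$-grading on $UT_{m'}(F)$, for positive integers $m,m'$, and let $\circ$, $\diamond$ be graded involutions on $\mathcal{U}$, $\mathcal{U}'$, respectively. Then $(\mathcal{U},\circ)$ and $(\mathcal{U}',\diamond)$ are isomorphic as $(G,\ast)$-algebras if and only if $T_{G,\ast}(\mathcal{U})=T_{G,\ast}(\mathcal{U}')$.
   Context: $UT_m(F)$ is the algebra of $m\times m$ upper triangular matrices over $F$. A $G$-grading on an algebra $A$ is a vector space decomposition $A=\oplus_{g\in G}A_g$ with $A_gA_h\subseteq A_{gh}$. An involution $\ast$ on $A$ is an $F$-linear map with $(a^\ast)^\ast=a$ and $(ab)^\ast=b^\ast a^\ast$; it is a graded involution if $A_g^\ast\subseteq A_g$ for all $g\in G$. A $G$-graded algebra with a graded involution is called a $(G,\ast)$-algebra. An isomorphism of $(G,\ast)$-algebras is an algebra isomorphism $\varphi:A\to B$ with $\varphi(A_g)\subseteq B_g$ for all $g$ and which intertwines the two involutions. The free $(G,\ast)$-algebra $F_{G,\ast}\langle X\rangle$ is the free associative algebra freely generated by the indeterminates $x_{i,g},x_{i,g}^\ast$ ($i\in\mathbb{N}$, $g\in G$), graded so that $x_{i,g},x_{i,g}^\ast$ have degree $g$, with the involution exchanging $x_{i,g}$ and $x_{i,g}^\ast$. For a $(G,\ast)$-algebra $A$, a polynomial $f(x_{i_1,g_1},\dots,x_{i_n,g_n})$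 of $F_{G,\ast}\langle X\rangle$ is a $(G,\ast)$-identity for $A$ if $f(a_1,\dots,a_n)=0$ for all $a_1\in A_{g_1},\dots,a_n\in A_{g_n}$ (where $x_{i_k,g_k}^\ast$ is evaluated at $a_k^\ast$). $T_{G,\ast}(A)$ denotes the set of all $(G,\ast)$-identities for $A$. *)

theory Defs
  imports
    Jordan_Normal_Form.Matrix
    "HOL-Algebra.Module"
    "HOL-Algebra.QuotRing"
    "HOL-Library.Poly_Mapping"
    "HOL-Computational_Algebra.Polynomial"
begin

text \<open>
  Algebras over the field \<open>'f\<close> are records of type \<open>('f, 'a) module\<close> (a ring with a carrier,
  together with a scalar multiplication); the locale of associative algebras in \<open>HOL-Algebra\<close> is
  not used because it presupposes commutativity. The grading group is an arbitrary type of class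
  \<open>ab_group_add\<close>, so the product of the group is written additively.
\<close>

definition UT :: "nat \<Rightarrow> ('f :: field, 'f mat) module" where
  "UT m = module_mat TYPE('f) m m \<lparr>carrier := {M \<in> carrier_mat m m. upper_triangular M}\<rparr>"


subsection \<open>Gradings and graded involutions\<close>

definition linear_subspace :: "('f :: field, 'a) module \<Rightarrow> 'a set \<Rightarrow> bool" where
  "linear_subspace A V \<longleftrightarrow>
     V \<subseteq> carrier A \<and> \<zero>\<^bsub>A\<^esub> \<in> V \<and>
     (\<forall>v\<in>V. \<forall>w\<in>V. v \<oplus>\<^bsub>A\<^esub> w \<in> V) \<and> (\<forall>c. \<forall>v\<in>V. c \<odot>\<^bsub>A\<^esub> v \<in> V)"

definition internal_direct_sum :: "('f :: field, 'a) module \<Rightarrow> ('g \<Rightarrow> 'a set) \<Rightarrow> bool" where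
  "internal_direct_sum A U \<longleftrightarrow>
     (\<forall>g. linear_subspace A (U g)) \<and>
     (\<forall>a\<in>carrier A. \<exists>!c. (\<forall>g. c g \<in> U g) \<and> finite {g. c g \<noteq> \<zero>\<^bsub>A\<^esub>} \<and>
        a = finsum A c {g. c g \<noteq> \<zero>\<^bsub>A\<^esub>})"

definition grading ::
  "('f :: field, 'a) module \<Rightarrow> ('g :: ab_group_add \<Rightarrow> 'a set) \<Rightarrow> bool" where
  "grading A U \<longleftrightarrow>
     internal_direct_sum A U \<and>
     (\<forall>g h. \<forall>a\<in>U g. \<forall>b\<in>U h. a \<otimes>\<^bsub>A\<^esub> b \<in> U (g + h))"

definition linear_map ::
  "('f :: field, 'a) module \<Rightarrow> ('f, 'b) module \<Rightarrow> ('a \<Rightarrow> 'b) \<Rightarrow> bool" where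
  "linear_map A B \<phi> \<longleftrightarrow>
     (\<forall>a\<in>carrier A. \<phi> a \<in> carrier B) \<and>
     (\<forall>a\<in>carrier A. \<forall>b\<in>carrier A. \<phi> (a \<oplus>\<^bsub>A\<^esub> b) = \<phi> a \<oplus>\<^bsub>B\<^esub> \<phi> b) \<and>
     (\<forall>c. \<forall>a\<in>carrier A. \<phi> (c \<odot>\<^bsub>A\<^esub> a) = c \<odot>\<^bsub>B\<^esub> \<phi> a)"

definition involution :: "('f :: field, 'a) module \<Rightarrow> ('a \<Rightarrow> 'a) \<Rightarrow> bool" where
  "involution A s \<longleftrightarrow>
     linear_map A A s \<and>
     (\<forall>a\<in>carrier A. s (s a) = a) \<and>
     (\<forall>a\<in>carrier A. \<forall>b\<in>carrier A. s (a \<otimes>\<^bsub>A\<^esub> b) = s b \<otimes>\<^bsub>A\<^esub> s a)"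

definition graded_involution ::
  "('f :: field, 'a) module \<Rightarrow> ('g :: ab_group_add \<Rightarrow> 'a set) \<Rightarrow> ('a \<Rightarrow> 'a) \<Rightarrow> bool" where
  "graded_involution A U s \<longleftrightarrow> involution A s \<and> (\<forall>g. s ` U g \<subseteq> U g)"

definition graded_star_isomorphic ::
  "('f :: field, 'a) module \<Rightarrow> ('g :: ab_group_add \<Rightarrow> 'a set) \<Rightarrow> ('a \<Rightarrow> 'a) \<Rightarrow>
   ('f, 'b) module \<Rightarrow> ('g \<Rightarrow> 'b set) \<Rightarrow> ('b \<Rightarrow> 'b) \<Rightarrow> bool" where
  "graded_star_isomorphic A U s B V t \<longleftrightarrow>
     (\<exists>\<phi>. \<phi> \<in> ring_iso A B \<and> linear_map A B \<phi> \<and>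
        (\<forall>g. \<phi> ` U g \<subseteq> V g) \<and>
        (\<forall>a\<in>carrier A. \<phi> (s a) = t (\<phi> a)))"


subsection \<open>The free algebra and its identities\<close>

text \<open>\<open>Var i g\<close> stands for the indeterminate \<open>x\<^bsub>i,g\<^esub>\<close> and \<open>StarVar i g\<close> for \<open>x\<^bsub>i,g\<^esub>\<^sup>*\<close>.\<close>

datatype 'g letter = Var nat 'g | StarVar nat 'g

text \<open>
  Words form a monoid under concatenation. It is written additively because the (convolution)
  product on \<open>'k \<Rightarrow>\<^sub>0 'f\<close> expects an additive monoid \<open>'k\<close> of exponents; with this instance
  \<open>'g word \<Rightarrow>\<^sub>0 'f\<close> is the free associative unital algebra on the letters.
\<close>

datatype 'g word = Word (letters: "'g letter list")

instantiation word :: (type) monoid_add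
begin

definition zero_word :: "'a word" where
  "0 = Word []"

definition plus_word :: "'a word \<Rightarrow> 'a word \<Rightarrow> 'a word" where
  "v + w = Word (letters v @ letters w)"

instance
  by standard (simp_all add: zero_word_def plus_word_def)

end

type_synonym ('g, 'f) free_star_algebra = "'g word \<Rightarrow>\<^sub>0 'f"

fun eval_letter :: "('a \<Rightarrow> 'a) \<Rightarrow> (nat \<Rightarrow> 'g \<Rightarrow> 'a) \<Rightarrow> 'g letter \<Rightarrow> 'a" where
  "eval_letter s a (Var i g) = a i g"
| "eval_letter s a (StarVar i g) = s (a i g)"

definition eval_word ::
  "('f :: field, 'a) module \<Rightarrow> ('a \<Rightarrow> 'a) \<Rightarrow> (nat \<Rightarrow> 'g \<Rightarrow> 'a) \<Rightarrow> 'g word \<Rightarrow> 'a" where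
  "eval_word A s a w = foldr (\<lambda>l r. eval_letter s a l \<otimes>\<^bsub>A\<^esub> r) (letters w) \<one>\<^bsub>A\<^esub>"

definition eval_poly ::
  "('f :: field, 'a) module \<Rightarrow> ('a \<Rightarrow> 'a) \<Rightarrow> (nat \<Rightarrow> 'g \<Rightarrow> 'a) \<Rightarrow>
   ('g, 'f) free_star_algebra \<Rightarrow> 'a" where
  "eval_poly A s a f =
     finsum A (\<lambda>w. Poly_Mapping.lookup f w \<odot>\<^bsub>A\<^esub> eval_word A s a w) (Poly_Mapping.keys f)"

text \<open>
  Values are assigned to all indeterminates at once. Only those occurring in \<open>f\<close> matter, and
  the others can always be given the value \<open>0\<close>, which lies in every homogeneous component.
\<close>

definition star_identities ::
  "('f :: field, 'a) module \<Rightarrow> ('g :: ab_group_add \<Rightarrow> 'a set) \<Rightarrow> ('a \<Rightarrow> 'a) \<Rightarrow>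
   ('g, 'f) free_star_algebra set" where
  "star_identities A U s =
     {f. \<forall>a. (\<forall>i g. a i g \<in> U g) \<longrightarrow> eval_poly A s a f = \<zero>\<^bsub>A\<^esub>}"

end

(*
  The commutators span the Jacobson radical J of UT m, so J and its powers are graded and invariant
  under the involution. Since J^(m-1) is one-dimensional, comparing X a Y with a_ii X Y for
  homogeneous X in J^i and Y in J^(m-1-i) shows that homogeneous elements of nonzero degree have zero
  diagonal and that the involution reverses diagonals. Hence, as F is infinite of characteristic other
  than 2, there is a skew element d of degree 0 with distinct eigenvalues. Diagonalizing d yields
  homogeneous matrix units F_ij, and the involution maps F_ij to a multiple of F_(m-1-j,m-1-i).

  Rescaling the units shows that m, the degrees of the F_(i,i+1) and the sign by which the involution
  acts on J^(m-1) determine the isomorphism class. The identities determine these data: a product of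
  commutators [x_i, y_i] with deg x_i = h_i and deg y_i = 0, of length k, takes values in J^k, and for
  k = m - 1 it is nonzero exactly if h_i = deg F_(i,i+1) for all i; the involution acts on its values
  by the sign.
*)
theory Submission
  imports Defs "Jordan_Normal_Form.Determinant"
begin

subsection \<open>Gradings by direct sums\<close>

text \<open>Diagonalizing any degree 0 element with distinct eigenvalues would already give
  homogeneous units, but nothing would tie them to the involution. Skewness supplies the tie:
  applying the involution to d x = \<lambda> x gives x* d = -\<lambda> x*, so the joint left and
  right eigenspaces of d are permuted, and they are lines because the eigenvalues are distinct.
  Since the involution reverses diagonals, the eigenvalues of a skew element are antisymmetric under
  i \<mapsto> m-1-i. Characteristic other than 2 enters twice: in taking the skew part, and in
  keeping opposite eigenvalues distinct.

  Conjugation by a diagonal matrix with entries \<rho> i changes the coefficients of the involution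
  only through the products of \<rho> i and \<rho> (m-1-i), which are symmetric under the
  reflection. This is why one sign survives as an invariant of the involution. For odd m the middle
  index is paired with itself, and its product is a square; F being algebraically closed supplies
  the root.\<close>

text \<open>The definition of a direct sum adds over exact supports. Here both families are summed
  over a common finite index set, so they can be compared without knowing their supports.\<close>

lemma direct_sum_unique:
  assumes "abelian_monoid A" "internal_direct_sum A U"
    and "finite S" "\<And>g. c g \<in> U g" "\<And>g. c' g \<in> U g"
    and "\<And>g. g \<notin> S \<Longrightarrow> c g = \<zero>\<^bsub>A\<^esub>" "\<And>g. g \<notin> S \<Longrightarrow> c' g = \<zero>\<^bsub>A\<^esub>"
    and "finsum A c S = finsum A c' S"
  shows "c = c'"
proof -
  interpret abelian_monoid A by fact
  have car: "x \<in> U g \<Longrightarrow> x \<in> carrier A" for x g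
    using assms(2) by (auto simp: internal_direct_sum_def linear_subspace_def)
  have supp: "finsum A b {g. b g \<noteq> \<zero>\<^bsub>A\<^esub>} = finsum A b S \<and> finite {g. b g \<noteq> \<zero>\<^bsub>A\<^esub>}"
    if "\<And>g. b g \<in> U g" "\<And>g. g \<notin> S \<Longrightarrow> b g = \<zero>\<^bsub>A\<^esub>" for b
  proof -
    have sub: "{g. b g \<noteq> \<zero>\<^bsub>A\<^esub>} \<subseteq> S" using that(2) by auto
    show ?thesis
    proof
      show "finsum A b {g. b g \<noteq> \<zero>\<^bsub>A\<^esub>} = finsum A b S"
        by (rule add.finprod_mono_neutral_cong_left) (use assms(3) sub that(2) car[OF that(1)] in auto)
    qed (use assms(3) sub finite_subset in blast)
  qed
  let ?D = "\<lambda>b. (\<forall>g. b g \<in> U g) \<and> finite {g. b g \<noteq> \<zero>\<^bsub>A\<^esub>} \<and>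
        finsum A c S = finsum A b {g. b g \<noteq> \<zero>\<^bsub>A\<^esub>}"
  have "finsum A c S \<in> carrier A"
    using assms(4) car by (intro finsum_closed) auto
  then have "\<exists>!b. ?D b"
    using assms(2) unfolding internal_direct_sum_def by blast
  moreover have "?D c" "?D c'"
    using supp[of c] supp[of c'] assms by auto
  ultimately show ?thesis by auto
qed

lemma direct_sum_exists:
  assumes "internal_direct_sum A U" "a \<in> carrier A"
  obtains c where "\<And>g. c g \<in> U g" "finite {g. c g \<noteq> \<zero>\<^bsub>A\<^esub>}"
    "a = finsum A c {g. c g \<noteq> \<zero>\<^bsub>A\<^esub>}"
  using assms unfolding internal_direct_sum_def by blast

lemma direct_sum_induct:
  assumes "abelian_monoid A" "internal_direct_sum A U" "a \<in> carrier A"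
    and hom: "\<And>g x. x \<in> U g \<Longrightarrow> P x"
    and add: "\<And>x y. x \<in> carrier A \<Longrightarrow> y \<in> carrier A \<Longrightarrow> P x \<Longrightarrow> P y \<Longrightarrow> P (x \<oplus>\<^bsub>A\<^esub> y)"
  shows "P a"
proof -
  interpret abelian_monoid A by fact
  have sub: "x \<in> U g \<Longrightarrow> x \<in> carrier A" "\<zero>\<^bsub>A\<^esub> \<in> U g" for x g
    using assms(2) by (auto simp: internal_direct_sum_def linear_subspace_def)
  obtain c where c: "\<And>g. c g \<in> U g" "finite {g. c g \<noteq> \<zero>\<^bsub>A\<^esub>}"
    "a = finsum A c {g. c g \<noteq> \<zero>\<^bsub>A\<^esub>}"
    using direct_sum_exists[OF assms(2,3)] by metis
  have "P (finsum A c S)" if "finite S" for S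
    using that
  proof (induction S)
    case empty
    then show ?case using hom sub by simp
  next
    case (insert g S)
    have "c \<in> S \<rightarrow> carrier A" "c g \<in> carrier A" using c(1) sub by auto
    then show ?case using insert.hyps insert.IH add[of "c g" "finsum A c S"] hom[OF c(1)] by simp
  qed
  then show ?thesis using c by simp
qed

lemma direct_sum_disjoint:
  assumes "abelian_monoid A" "internal_direct_sum A U" "x \<in> U g" "x \<in> U h" "g \<noteq> h"
  shows "x = \<zero>\<^bsub>A\<^esub>"
proof -
  interpret abelian_monoid A by fact
  have sub: "x \<in> U k \<Longrightarrow> x \<in> carrier A" "\<zero>\<^bsub>A\<^esub> \<in> U k" for x k
    using assms(2) by (auto simp: internal_direct_sum_def linear_subspace_def)
  have "(\<lambda>k. if k = g then x else \<zero>\<^bsub>A\<^esub>) = (\<lambda>k. if k = h then x else \<zero>\<^bsub>A\<^esub>)"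
    by (rule direct_sum_unique[OF assms(1,2), of "{g, h}"])
      (use sub assms in \<open>auto simp: subset_iff\<close>)
  then show ?thesis using \<open>g \<noteq> h\<close> by (metis (full_types))
qed

text \<open>An isomorphism is only required to map \<open>U g\<close> into \<open>V g\<close>.
  Surjectivity onto \<open>V g\<close> follows from uniqueness of decompositions: the images of the
  components of a preimage of \<open>b\<close> decompose \<open>b\<close>, which is its own
  component of degree \<open>g\<close>. This lifts assignments back along an isomorphism.\<close>

lemma graded_iso_image:
  assumes "abelian_monoid A" "abelian_monoid B"
    and "internal_direct_sum A U" "internal_direct_sum B V"
    and \<phi>: "\<phi> \<in> ring_iso A B" "\<phi> \<zero>\<^bsub>A\<^esub> = \<zero>\<^bsub>B\<^esub>" "\<And>g. \<phi> ` U g \<subseteq> V g" and "b \<in> V g"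
  shows "b \<in> \<phi> ` U g"
proof -
  interpret A: abelian_monoid A by fact
  interpret B: abelian_monoid B by fact
  have subU: "x \<in> U k \<Longrightarrow> x \<in> carrier A" "\<zero>\<^bsub>A\<^esub> \<in> U k"
    and subV: "y \<in> V k \<Longrightarrow> y \<in> carrier B" "\<zero>\<^bsub>B\<^esub> \<in> V k" for x y k
    using assms(3,4) by (auto simp: internal_direct_sum_def linear_subspace_def)
  obtain a where a: "a \<in> carrier A" "b = \<phi> a"
    using \<phi>(1) \<open>b \<in> V g\<close> subV unfolding ring_iso_def bij_betw_def by blast
  obtain c where c: "\<And>g. c g \<in> U g" "finite {g. c g \<noteq> \<zero>\<^bsub>A\<^esub>}"
    "a = finsum A c {g. c g \<noteq> \<zero>\<^bsub>A\<^esub>}"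
    using direct_sum_exists[OF assms(3) a(1)] by metis
  let ?S = "insert g {g. c g \<noteq> \<zero>\<^bsub>A\<^esub>}"
  have hom: "\<phi> (finsum A c S) = finsum B (\<lambda>k. \<phi> (c k)) S" if "finite S" for S
    using that
  proof (induction S)
    case empty
    then show ?case using \<phi>(2) by simp
  next
    case (insert k S)
    have cS: "c \<in> S \<rightarrow> carrier A" "c k \<in> carrier A" using c(1) subU by auto
    have \<phi>S: "(\<lambda>k. \<phi> (c k)) \<in> S \<rightarrow> carrier B" "\<phi> (c k) \<in> carrier B"
      using c(1) \<phi>(3) subV by blast+
    have "\<phi> (c k \<oplus>\<^bsub>A\<^esub> finsum A c S) = \<phi> (c k) \<oplus>\<^bsub>B\<^esub> \<phi> (finsum A c S)"
      using \<phi>(1) cS by (intro ring_hom_add) (auto simp: ring_iso_def)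
    with insert cS \<phi>S show ?case by simp
  qed
  have "finsum A c ?S = a"
    unfolding c(3)
    by (rule A.add.finprod_mono_neutral_cong_right) (use c subU in auto)
  then have b: "b = finsum B (\<lambda>k. \<phi> (c k)) ?S"
    using hom[of ?S] c(2) a(2) by simp
  have bg: "finsum B (\<lambda>k. if k = g then b else \<zero>\<^bsub>B\<^esub>) ?S = b"
  proof -
    have "finsum B (\<lambda>k. if k = g then b else \<zero>\<^bsub>B\<^esub>) ?S = finsum B (\<lambda>k. b) {g}"
      by (rule B.add.finprod_mono_neutral_cong_right) (use c \<open>b \<in> V g\<close> subV in auto)
    then show ?thesis using \<open>b \<in> V g\<close> subV by auto
  qed
  have "(\<lambda>k. \<phi> (c k)) = (\<lambda>k. if k = g then b else \<zero>\<^bsub>B\<^esub>)"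
    by (rule direct_sum_unique[OF assms(2,4), of ?S])
      (use c \<phi> subV \<open>b \<in> V g\<close> b bg in \<open>auto simp: image_subset_iff\<close>)
  from fun_cong[OF this, of g] have "\<phi> (c g) = b" by simp
  then show ?thesis using c(1) by blast
qed

text \<open>The degree 0 component of the unit is a right identity: expanding \<open>a\<close> times
  the unit for homogeneous \<open>a\<close> and comparing components in the degree of
  \<open>a\<close> leaves only the product with \<open>c 0\<close>. A right identity in a ring with
  unit is the unit.\<close>

lemma one_homogeneous:
  assumes "ring A" "grading A U"
  shows "\<one>\<^bsub>A\<^esub> \<in> U 0"
proof -
  interpret ring A by fact
  have am: "abelian_monoid A" ..
  have ds: "internal_direct_sum A U" using assms(2) by (simp add: grading_def)
  have mult: "a \<otimes>\<^bsub>A\<^esub> b \<in> U (g + h)" if "a \<in> U g" "b \<in> U h" for a b g h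
    using assms(2) that by (auto simp: grading_def)
  have sub: "x \<in> U k \<Longrightarrow> x \<in> carrier A" "\<zero>\<^bsub>A\<^esub> \<in> U k" for x k
    using ds by (auto simp: internal_direct_sum_def linear_subspace_def)
  obtain c where c: "\<And>g. c g \<in> U g" "finite {g. c g \<noteq> \<zero>\<^bsub>A\<^esub>}"
    "\<one>\<^bsub>A\<^esub> = finsum A c {g. c g \<noteq> \<zero>\<^bsub>A\<^esub>}"
    using direct_sum_exists[OF ds one_closed] by metis
  let ?S = "{g. c g \<noteq> \<zero>\<^bsub>A\<^esub>}"
  have car: "c k \<in> carrier A" for k using c(1) sub by auto
  have right_unit: "a \<otimes>\<^bsub>A\<^esub> c 0 = a" if a: "a \<in> U h" for a h
  proof -
    let ?T = "insert h ((+) h ` ?S)"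
    have aC: "a \<in> carrier A" using a sub by auto
    have in': "a \<otimes>\<^bsub>A\<^esub> c (k - h) \<in> U k" for k
      using mult[OF a c(1)[of "k - h"]] by simp
    \<comment> \<open>Both families decompose \<open>a\<close>: the first is the product of
      \<open>a\<close> with the decomposition of the unit, reindexed by total degree.\<close>
    have "(\<lambda>k. a \<otimes>\<^bsub>A\<^esub> c (k - h)) = (\<lambda>k. if k = h then a else \<zero>\<^bsub>A\<^esub>)"
    proof (rule direct_sum_unique[OF am ds, of ?T])
      show "a \<otimes>\<^bsub>A\<^esub> c (k - h) = \<zero>\<^bsub>A\<^esub>" if "k \<notin> ?T" for k
      proof -
        have "k - h \<notin> ?S" using that by (metis add.commute diff_add_cancel image_eqI insertCI)
        then show ?thesis using aC by simp
      qed
      have "finsum A (\<lambda>k. a \<otimes>\<^bsub>A\<^esub> c (k - h)) ?T = finsum A (\<lambda>k. a \<otimes>\<^bsub>A\<^esub> c (k - h)) ((+) h ` ?S)"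
      proof (rule add.finprod_mono_neutral_cong_right)
        show "a \<otimes>\<^bsub>A\<^esub> c (k - h) = \<zero>\<^bsub>A\<^esub>" if "k \<in> ?T - (+) h ` ?S" for k
        proof -
          have "k - h \<notin> ?S" using that
            by (metis (no_types, lifting) DiffD2 add.commute diff_add_cancel image_eqI)
          then show ?thesis using aC by simp
        qed
      qed (use c aC car in auto)
      also have "\<dots> = finsum A (\<lambda>k. a \<otimes>\<^bsub>A\<^esub> c k) ?S"
        by (subst finsum_reindex) (use aC car in auto)
      also have "\<dots> = a \<otimes>\<^bsub>A\<^esub> finsum A c ?S"
        by (rule finsum_rdistr[symmetric]) (use c aC car in auto)
      also have "\<dots> = a" using aC by (simp flip: c(3))
      also have "a = finsum A (\<lambda>k. a) {h}" using aC by simp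
      also have "\<dots> = finsum A (\<lambda>k. if k = h then a else \<zero>\<^bsub>A\<^esub>) ?T"
        by (rule add.finprod_mono_neutral_cong_left) (use c aC in auto)
      finally show "finsum A (\<lambda>k. a \<otimes>\<^bsub>A\<^esub> c (k - h)) ?T = finsum A (\<lambda>k. if k = h then a else \<zero>\<^bsub>A\<^esub>) ?T" .
    qed (use c a in' sub in auto)
    from fun_cong[OF this, of h] show ?thesis by simp
  qed
  have "a \<otimes>\<^bsub>A\<^esub> c 0 = a" if "a \<in> carrier A" for a
    by (rule direct_sum_induct[OF am ds that]) (use right_unit car in \<open>auto simp: l_distr\<close>)
  from this[OF one_closed] have "c 0 = \<one>\<^bsub>A\<^esub>" using car by simp
  then show ?thesis using c(1)[of 0] by simp
qed

subsection \<open>Upper triangular matrices and the radical filtration\<close>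

lemma UT_simps:
  "mult (UT m) = (*)" "add (UT m) = (+)" "one (UT m) = 1\<^sub>m m" "zero (UT m) = 0\<^sub>m m m"
  "module.smult (UT m) = (\<cdot>\<^sub>m)" "carrier (UT m) = {M \<in> carrier_mat m m. upper_triangular M}"
  by (simp_all add: UT_def module_mat_def)

lemma UT_carrier_iff:
  "a \<in> carrier (UT m) \<longleftrightarrow> a \<in> carrier_mat m m \<and> (\<forall>i<m. \<forall>j<i. a $$ (i, j) = 0)"
  by (auto simp: UT_simps upper_triangular_def)

lemma UT_carrier_mat: "a \<in> carrier (UT m) \<Longrightarrow> a \<in> carrier_mat m m"
  by (simp add: UT_simps)

lemma UT_dims [simp]:
  assumes "a \<in> carrier (UT m)" shows "dim_row a = m" "dim_col a = m"
  using assms by (auto simp: UT_simps)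

declare index_mult_mat(1) [simp del]

lemma index_mult_mat_sum:
  assumes "a \<in> carrier_mat n k" "b \<in> carrier_mat k m" "i < n" "j < m"
  shows "(a * b) $$ (i, j) = (\<Sum>l<k. a $$ (i, l) * b $$ (l, j))"
  using assms by (auto simp: index_mult_mat(1) scalar_prod_def atLeast0LessThan)

text \<open>\<open>strip m k\<close> is the \<open>k\<close>-th power of the Jacobson radical of \<open>UT m\<close>.\<close>

definition strip :: "nat \<Rightarrow> nat \<Rightarrow> 'f::field mat set" where
  "strip m k = {a \<in> carrier_mat m m. \<forall>i<m. \<forall>j<m. j < i + k \<longrightarrow> a $$ (i, j) = 0}"

lemma strip_0: "strip m 0 = carrier (UT m)"
  by (auto simp: strip_def UT_carrier_iff)

lemma stripD: "a \<in> strip m k \<Longrightarrow> i < m \<Longrightarrow> j < m \<Longrightarrow> j < i + k \<Longrightarrow> a $$ (i, j) = 0"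
  by (simp add: strip_def)

lemma strip_carrier_mat: "a \<in> strip m k \<Longrightarrow> a \<in> carrier_mat m m"
  by (simp add: strip_def)

lemma strip_UT: "a \<in> strip m k \<Longrightarrow> a \<in> carrier (UT m)"
  by (auto simp: strip_def UT_carrier_iff)

lemma strip_smult: "a \<in> strip m k \<Longrightarrow> c \<cdot>\<^sub>m a \<in> strip m k"
  by (auto simp: strip_def)

lemma strip_mult:
  assumes "a \<in> strip m k" "b \<in> strip m l"
  shows "a * b \<in> strip m (k + l)"
proof -
  have "(a * b) $$ (i, j) = 0" if "i < m" "j < m" "j < i + (k + l)" for i j
  proof -
    have "(a * b) $$ (i, j) = (\<Sum>p<m. a $$ (i, p) * b $$ (p, j))"
      using assms that by (intro index_mult_mat_sum) (auto simp: strip_def)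
    also have "\<dots> = 0"
    proof (rule sum.neutral, rule ballI)
      fix p assume p: "p \<in> {..<m}"
      show "a $$ (i, p) * b $$ (p, j) = 0"
      proof (cases "p < i + k")
        case True
        then show ?thesis using stripD[OF assms(1)] that p by simp
      next
        case False
        then show ?thesis using stripD[OF assms(2)] that p by simp
      qed
    qed
    finally show ?thesis .
  qed
  then show ?thesis using assms by (auto simp: strip_def)
qed

text \<open>The first factor kills the indices below \<open>i + k\<close>, the second those above
  it, so one summand survives. Leading entries are thus multiplicative along a path, which is the
  source of all later nonvanishing statements.\<close>

lemma strip_mult_entry:
  assumes "a \<in> strip m k" "b \<in> strip m l" "i + k + l < m"
  shows "(a * b) $$ (i, i + k + l) = a $$ (i, i + k) * b $$ (i + k, i + k + l)"
proof -
  have "(a * b) $$ (i, i + k + l) = (\<Sum>p<m. a $$ (i, p) * b $$ (p, i + k + l))"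
    using assms by (intro index_mult_mat_sum) (auto simp: strip_def)
  also have "\<dots> = (\<Sum>p\<in>{i + k}. a $$ (i, p) * b $$ (p, i + k + l))"
  proof (rule sum.mono_neutral_right)
    show "\<forall>p\<in>{..<m} - {i + k}. a $$ (i, p) * b $$ (p, i + k + l) = 0"
    proof
      fix p assume p: "p \<in> {..<m} - {i + k}"
      show "a $$ (i, p) * b $$ (p, i + k + l) = 0"
      proof (cases "p < i + k")
        case True
        then show ?thesis using stripD[OF assms(1)] assms(3) p by simp
      next
        case False
        then show ?thesis using stripD[OF assms(2)] assms(3) p by simp
      qed
    qed
  qed (use assms in auto)
  finally show ?thesis by simp
qed

lemma strip_eqI:
  assumes "a \<in> strip m k" "b \<in> strip m k"
    and "\<And>i j. j < m \<Longrightarrow> i + k \<le> j \<Longrightarrow> a $$ (i, j) = b $$ (i, j)"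
  shows "a = b"
proof (rule eq_matI)
  fix i j assume "i < dim_row b" "j < dim_col b"
  then have "i < m" "j < m" using assms(2) by (auto simp: strip_def)
  then show "a $$ (i, j) = b $$ (i, j)"
    using stripD[OF assms(1)] stripD[OF assms(2)] assms(3) by (cases "j < i + k") auto
qed (use assms in \<open>auto simp: strip_def\<close>)

lemma UT_eqI:
  assumes "a \<in> carrier (UT m)" "b \<in> carrier (UT m)"
    and "\<And>i j. j < m \<Longrightarrow> i \<le> j \<Longrightarrow> a $$ (i, j) = b $$ (i, j)"
  shows "a = b"
  using assms by (intro strip_eqI[of a m 0 b]) (auto simp: strip_0)

lemma UT_mult_closed [simp]:
  "a \<in> carrier (UT m) \<Longrightarrow> b \<in> carrier (UT m) \<Longrightarrow> a * b \<in> carrier (UT m)"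
  using strip_mult[of a m 0 b 0] by (simp add: strip_0)

lemma UT_linear_closed [simp]:
  assumes "a \<in> carrier (UT m)"
  shows "b \<in> carrier (UT m) \<Longrightarrow> a + b \<in> carrier (UT m)"
    and "b \<in> carrier (UT m) \<Longrightarrow> a - b \<in> carrier (UT m)"
    and "c \<cdot>\<^sub>m a \<in> carrier (UT m)"
  using assms by (auto simp: UT_carrier_iff)

lemma UT_one_zero [simp]: "1\<^sub>m m \<in> carrier (UT m)" "0\<^sub>m m m \<in> carrier (UT m)"
  by (auto simp: UT_simps)

lemma UT_diag_mult:
  assumes "a \<in> carrier (UT m)" "b \<in> carrier (UT m)" "i < m"
  shows "(a * b) $$ (i, i) = a $$ (i, i) * b $$ (i, i)"
  using strip_mult_entry[of a m 0 b 0 i] assms by (simp add: strip_0)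

lemma UT_assoc:
  assumes "a \<in> carrier (UT m)" "b \<in> carrier (UT m)" "c \<in> carrier (UT m)"
  shows "a * b * c = a * (b * c)"
  by (rule assoc_mult_mat) (use assms UT_carrier_mat in blast)+

lemma UT_ring: "ring (UT m :: ('f::field, 'f mat) module)"
proof (rule ringI)
  show "abelian_group (UT m :: ('f, 'f mat) module)"
  proof (rule abelian_groupI)
    fix x y z :: "'f mat" assume x: "x \<in> carrier (UT m)"
    show "\<exists>y\<in>carrier (UT m). y \<oplus>\<^bsub>UT m\<^esub> x = \<zero>\<^bsub>UT m\<^esub>"
    proof (rule bexI)
      show "(-1) \<cdot>\<^sub>m x \<oplus>\<^bsub>UT m\<^esub> x = \<zero>\<^bsub>UT m\<^esub>"
        unfolding UT_simps(2,4) by (rule eq_matI) (use x in auto)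
    qed (use x in simp)
    assume y: "y \<in> carrier (UT m)"
    show "x \<oplus>\<^bsub>UT m\<^esub> y = y \<oplus>\<^bsub>UT m\<^esub> x"
      unfolding UT_simps(2) by (rule comm_add_mat) (use x y UT_carrier_mat in blast)+
    assume z: "z \<in> carrier (UT m)"
    show "x \<oplus>\<^bsub>UT m\<^esub> y \<oplus>\<^bsub>UT m\<^esub> z = x \<oplus>\<^bsub>UT m\<^esub> (y \<oplus>\<^bsub>UT m\<^esub> z)"
      unfolding UT_simps(2) by (rule assoc_add_mat) (use x y z UT_carrier_mat in blast)+
  next
    fix x :: "'f mat" assume x: "x \<in> carrier (UT m)"
    show "\<zero>\<^bsub>UT m\<^esub> \<oplus>\<^bsub>UT m\<^esub> x = x"
      unfolding UT_simps(2,4) by (rule left_add_zero_mat) (use x UT_carrier_mat in blast)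
  qed (simp_all add: UT_simps(2,4))
  show "monoid (UT m :: ('f, 'f mat) module)"
  proof (rule monoidI)
    fix x y z :: "'f mat"
    assume x: "x \<in> carrier (UT m)"
    show "\<one>\<^bsub>UT m\<^esub> \<otimes>\<^bsub>UT m\<^esub> x = x" "x \<otimes>\<^bsub>UT m\<^esub> \<one>\<^bsub>UT m\<^esub> = x"
      using UT_carrier_mat[OF x] by (simp_all add: UT_simps(1,3))
    assume "y \<in> carrier (UT m)" "z \<in> carrier (UT m)"
    with x show "x \<otimes>\<^bsub>UT m\<^esub> y \<otimes>\<^bsub>UT m\<^esub> z = x \<otimes>\<^bsub>UT m\<^esub> (y \<otimes>\<^bsub>UT m\<^esub> z)"
      unfolding UT_simps(1) by (intro assoc_mult_mat) (use UT_carrier_mat in blast)+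
  qed (simp_all add: UT_simps(1,3))
next
  fix x y z :: "'f mat"
  assume "x \<in> carrier (UT m)" "y \<in> carrier (UT m)" "z \<in> carrier (UT m)"
  note xyz = this[THEN UT_carrier_mat]
  show "(x \<oplus>\<^bsub>UT m\<^esub> y) \<otimes>\<^bsub>UT m\<^esub> z = x \<otimes>\<^bsub>UT m\<^esub> z \<oplus>\<^bsub>UT m\<^esub> y \<otimes>\<^bsub>UT m\<^esub> z"
    unfolding UT_simps(1,2) using xyz by (rule add_mult_distrib_mat)
  show "z \<otimes>\<^bsub>UT m\<^esub> (x \<oplus>\<^bsub>UT m\<^esub> y) = z \<otimes>\<^bsub>UT m\<^esub> x \<oplus>\<^bsub>UT m\<^esub> z \<otimes>\<^bsub>UT m\<^esub> y"
    unfolding UT_simps(1,2) using xyz(3,1,2) by (rule mult_add_distrib_mat)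
qed

lemma UT_abelian_monoid: "abelian_monoid (UT m :: ('f::field, 'f mat) module)"
  by (rule abelian_group.axioms(1)[OF ring.is_abelian_group[OF UT_ring]])

text \<open>Taking a diagonal entry is multiplicative with values in a commutative field, so it
  vanishes on commutators.\<close>

lemma strip_commutator:
  assumes "a \<in> carrier (UT m)" "b \<in> carrier (UT m)"
  shows "a * b - b * a \<in> strip m 1"
proof -
  let ?c = "a * b - b * a"
  have c: "?c \<in> carrier (UT m)" using assms by simp
  have "?c $$ (i, j) = 0" if "i < m" "j < m" "j < i + 1" for i j
  proof (cases "j = i")
    case True
    have "?c $$ (i, i) = (a * b) $$ (i, i) - (b * a) $$ (i, i)"
      using assms that by (intro index_minus_mat) auto
    then show ?thesis using True assms that by (simp add: UT_diag_mult)
  next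
    case False
    then show ?thesis using c that by (simp add: UT_carrier_iff)
  qed
  then show ?thesis using c by (auto simp: strip_def UT_carrier_iff)
qed

section \<open>Standard matrix units\<close>

definition mat_unit :: "nat \<Rightarrow> nat \<Rightarrow> nat \<Rightarrow> 'f::field mat" where
  "mat_unit m i j = mat m m (\<lambda>(p, q). if p = i \<and> q = j then 1 else 0)"

lemma mat_unit_carrier [simp]: "mat_unit m i j \<in> carrier_mat m m"
  and mat_unit_dims [simp]: "dim_row (mat_unit m i j) = m" "dim_col (mat_unit m i j) = m"
  by (auto simp: mat_unit_def)

lemma mat_unit_index [simp]:
  "p < m \<Longrightarrow> q < m \<Longrightarrow> mat_unit m i j $$ (p, q) = (if p = i \<and> q = j then 1 else 0)"
  by (simp add: mat_unit_def)

lemma mat_unit_UT [simp]: "i \<le> j \<Longrightarrow> mat_unit m i j \<in> carrier (UT m)"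
  by (auto simp: UT_carrier_iff)

lemma mat_unit_mult_index:
  assumes "a \<in> carrier_mat m m" "i < m" "j < m" "p < m" "q < m"
  shows "(mat_unit m i j * a) $$ (p, q) = (if p = i then a $$ (j, q) else 0)"
proof -
  have "(mat_unit m i j * a) $$ (p, q) = (\<Sum>l<m. mat_unit m i j $$ (p, l) * a $$ (l, q))"
    using assms by (intro index_mult_mat_sum) auto
  also have "\<dots> = (\<Sum>l<m. if l = j then (if p = i then a $$ (j, q) else 0) else 0)"
    by (rule sum.cong) (use assms in auto)
  finally show ?thesis using assms by simp
qed

lemma mult_mat_unit_index:
  assumes "a \<in> carrier_mat m m" "i < m" "j < m" "p < m" "q < m"
  shows "(a * mat_unit m i j) $$ (p, q) = (if q = j then a $$ (p, i) else 0)"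
proof -
  have "(a * mat_unit m i j) $$ (p, q) = (\<Sum>l<m. a $$ (p, l) * mat_unit m i j $$ (l, q))"
    using assms by (intro index_mult_mat_sum) auto
  also have "\<dots> = (\<Sum>l<m. if l = i then (if q = j then a $$ (p, i) else 0) else 0)"
    by (rule sum.cong) (use assms in auto)
  finally show ?thesis using assms by simp
qed

lemma mat_unit_mult:
  assumes "i < m" "j < m" "k < m" "l < m"
  shows "mat_unit m i j * mat_unit m k l = (if j = k then mat_unit m i l else 0\<^sub>m m m)"
  by (rule eq_matI) (use assms in \<open>auto simp: mat_unit_mult_index\<close>)

lemma mat_unit_sandwich:
  assumes "a \<in> carrier_mat m m" "i < m" "j < m"
  shows "mat_unit m i i * a * mat_unit m j j = a $$ (i, j) \<cdot>\<^sub>m mat_unit m i j"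
proof (rule eq_matI)
  fix p q assume "p < dim_row (a $$ (i, j) \<cdot>\<^sub>m mat_unit m i j)"
    "q < dim_col (a $$ (i, j) \<cdot>\<^sub>m (mat_unit m i j :: 'a mat))"
  then have pq: "p < m" "q < m" by auto
  have "mat_unit m i i * a \<in> carrier_mat m m" using assms by (intro mult_carrier_mat) auto
  then show "(mat_unit m i i * a * mat_unit m j j) $$ (p, q) = (a $$ (i, j) \<cdot>\<^sub>m mat_unit m i j) $$ (p, q)"
    using assms pq by (simp add: mult_mat_unit_index mat_unit_mult_index)
qed (use assms in auto)

text \<open>The unit case carries the actual coefficient of \<open>a\<close> instead of an arbitrary
  scalar, so that positions where \<open>a\<close> vanishes can be treated separately.\<close>

lemma UT_span_mat_unit:
  assumes a: "a \<in> carrier (UT m)"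
    and zero: "P (0\<^sub>m m m)"
    and add: "\<And>x y. x \<in> carrier (UT m) \<Longrightarrow> y \<in> carrier (UT m) \<Longrightarrow> P x \<Longrightarrow> P y \<Longrightarrow> P (x + y)"
    and unit: "\<And>i j. i \<le> j \<Longrightarrow> j < m \<Longrightarrow> P (a $$ (i, j) \<cdot>\<^sub>m mat_unit m i j)"
  shows "P a"
proof -
  let ?I = "{(i, j). i \<le> j \<and> j < m}"
  let ?r = "\<lambda>S. mat m m (\<lambda>ij. if ij \<in> S then a $$ ij else 0)"
  have fin: "finite ?I" by (rule finite_subset[of _ "{..<m} \<times> {..<m}"]) auto
  have "?r S \<in> carrier (UT m) \<and> P (?r S)" if "finite S" "S \<subseteq> ?I" for S
    using that
  proof (induction S)
    case empty
    have "?r {} = 0\<^sub>m m m" by (rule eq_matI) auto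
    then show ?case using zero by simp
  next
    case (insert ij S)
    obtain i j where ij: "ij = (i, j)" "i \<le> j" "j < m" using insert.prems by auto
    have "?r (insert ij S) = a $$ (i, j) \<cdot>\<^sub>m mat_unit m i j + ?r S"
      by (rule eq_matI) (use insert.hyps ij in auto)
    moreover have "a $$ (i, j) \<cdot>\<^sub>m mat_unit m i j \<in> carrier (UT m)"
      using ij by simp
    moreover have "?r S \<in> carrier (UT m)" "P (?r S)" using insert by auto
    ultimately show ?case using add[OF _ _ unit[OF ij(2,3)]] UT_linear_closed(1) by simp
  qed
  from this[OF fin] have P: "P (?r ?I)" by blast
  have eq: "?r ?I = a"
    by (rule eq_matI) (use a in \<open>auto simp: UT_carrier_iff\<close>)
  show ?thesis using P unfolding eq .
qed

text \<open>Both sides lie in the one-dimensional top power of the radical.\<close>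

lemma strip_sandwich:
  assumes "x \<in> strip m k" "a \<in> carrier (UT m)" "y \<in> strip m l" "k + l + 1 = m"
  shows "x * a * y = a $$ (k, k) \<cdot>\<^sub>m (x * y)"
proof -
  have xa: "x * a \<in> strip m k" using strip_mult[OF assms(1), of a 0] assms(2) by (simp add: strip_0)
  have xay: "x * a * y \<in> strip m (k + l)" using strip_mult[OF xa assms(3)] .
  have xy: "x * y \<in> strip m (k + l)" using strip_mult[OF assms(1,3)] .
  have e1: "(x * a * y) $$ (0, k + l) = x $$ (0, k) * a $$ (k, k) * y $$ (k, k + l)"
    using strip_mult_entry[OF xa assms(3), of 0] strip_mult_entry[OF assms(1), of a 0 0] assms
    by (simp add: strip_0)
  have e2: "(x * y) $$ (0, k + l) = x $$ (0, k) * y $$ (k, k + l)"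
    using strip_mult_entry[OF assms(1,3), of 0] assms by simp
  show ?thesis
  proof (rule strip_eqI[OF xay])
    show "a $$ (k, k) \<cdot>\<^sub>m (x * y) \<in> strip m (k + l)"
      using xy by (rule strip_smult)
    fix i j assume "j < m" "i + (k + l) \<le> j"
    then have "i = 0" "j = k + l" using assms(4) by auto
    moreover have "(a $$ (k, k) \<cdot>\<^sub>m (x * y)) $$ (0, k + l) = a $$ (k, k) * (x * y) $$ (0, k + l)"
      using strip_carrier_mat[OF xy] assms(4) by (intro index_smult_mat(1)) auto
    ultimately show "(x * a * y) $$ (i, j) = (a $$ (k, k) \<cdot>\<^sub>m (x * y)) $$ (i, j)"
      using e1 e2 by simp
  qed
qed

subsection \<open>Diagonals of homogeneous elements and of the involution\<close>

lemma UT_minus_conv: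
  assumes "a \<in> carrier (UT m)" "b \<in> carrier (UT m)"
  shows "a - b = a + (-1) \<cdot>\<^sub>m b"
  by (rule eq_matI) (use assms in auto)

lemma smult_mat_cancel:
  fixes a :: "'f::field mat"
  assumes "a \<in> carrier_mat n m" "a \<noteq> 0\<^sub>m n m" "c \<cdot>\<^sub>m a = d \<cdot>\<^sub>m a"
  shows "c = d"
proof -
  have "\<exists>i<n. \<exists>j<m. a $$ (i, j) \<noteq> 0"
  proof (rule ccontr)
    assume "\<not> ?thesis"
    then have "a = 0\<^sub>m n m" using assms(1) by (intro eq_matI) auto
    then show False using assms(2) by simp
  qed
  then obtain i j where ij: "i < n" "j < m" "a $$ (i, j) \<noteq> 0" by blast
  have "c * a $$ (i, j) = d * a $$ (i, j)"
    using arg_cong[OF assms(3), of "\<lambda>M. M $$ (i, j)"] ij assms(1) by simp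
  then show ?thesis using ij(3) by simp
qed

lemma zero_smult_mat: "a \<in> carrier_mat n m \<Longrightarrow> (0::'f::field) \<cdot>\<^sub>m a = 0\<^sub>m n m"
  by (rule eq_matI) auto

locale UT_graded_star =
  fixes m :: nat
    and U :: "'g :: ab_group_add \<Rightarrow> 'f :: alg_closed_field mat set"
    and s :: "'f mat \<Rightarrow> 'f mat"
  assumes m_pos: "m > 0"
    and grading: "grading (UT m) U"
    and graded_involution: "graded_involution (UT m) U s"
begin

lemmas UT_dims_m [simp] = UT_dims[where m = m]

lemma direct_sum: "internal_direct_sum (UT m) U"
  using grading by (simp add: grading_def)

lemma U_UT: "x \<in> U g \<Longrightarrow> x \<in> carrier (UT m)"
  using direct_sum by (auto simp: internal_direct_sum_def linear_subspace_def)

lemma U_zero: "0\<^sub>m m m \<in> U g"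
  and U_add: "x \<in> U g \<Longrightarrow> y \<in> U g \<Longrightarrow> x + y \<in> U g"
  and U_smult: "x \<in> U g \<Longrightarrow> c \<cdot>\<^sub>m x \<in> U g"
  using direct_sum by (auto simp: internal_direct_sum_def linear_subspace_def UT_simps(2,4,5))

lemma U_minus:
  assumes "x \<in> U g" "y \<in> U g" shows "x - y \<in> U g"
  unfolding UT_minus_conv[OF assms[THEN U_UT]] using assms by (intro U_add U_smult)

lemma U_mult: "x \<in> U g \<Longrightarrow> y \<in> U h \<Longrightarrow> x * y \<in> U (g + h)"
  using grading by (auto simp: grading_def UT_simps(1))

lemma U_one: "1\<^sub>m m \<in> U 0"
  using one_homogeneous[OF UT_ring grading] by (simp add: UT_simps(3))

lemma U_disjoint: "x \<in> U g \<Longrightarrow> x \<in> U h \<Longrightarrow> g \<noteq> h \<Longrightarrow> x = 0\<^sub>m m m"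
  using direct_sum_disjoint[OF UT_abelian_monoid direct_sum] by (simp add: UT_simps(4))

lemma U_induct:
  assumes "a \<in> carrier (UT m)" "\<And>g x. x \<in> U g \<Longrightarrow> P x"
    and "\<And>x y. x \<in> carrier (UT m) \<Longrightarrow> y \<in> carrier (UT m) \<Longrightarrow> P x \<Longrightarrow> P y \<Longrightarrow> P (x + y)"
  shows "P a"
  using direct_sum_induct[OF UT_abelian_monoid direct_sum, of a P] assms
  unfolding UT_simps(2) by blast

lemma star_UT [simp]: "a \<in> carrier (UT m) \<Longrightarrow> s a \<in> carrier (UT m)"
  and star_add: "a \<in> carrier (UT m) \<Longrightarrow> b \<in> carrier (UT m) \<Longrightarrow> s (a + b) = s a + s b"
  and star_smult: "a \<in> carrier (UT m) \<Longrightarrow> s (c \<cdot>\<^sub>m a) = c \<cdot>\<^sub>m s a"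
  and star_star [simp]: "a \<in> carrier (UT m) \<Longrightarrow> s (s a) = a"
  and star_mult: "a \<in> carrier (UT m) \<Longrightarrow> b \<in> carrier (UT m) \<Longrightarrow> s (a * b) = s b * s a"
  using graded_involution
  by (auto simp: graded_involution_def involution_def linear_map_def UT_simps(1,2,5))

lemma star_U: "a \<in> U g \<Longrightarrow> s a \<in> U g"
  using graded_involution by (auto simp: graded_involution_def)

lemma star_minus:
  assumes "a \<in> carrier (UT m)" "b \<in> carrier (UT m)"
  shows "s (a - b) = s a - s b"
  using assms UT_minus_conv[OF assms] UT_minus_conv[OF assms[THEN star_UT]]
  by (simp add: star_add star_smult)

lemma star_zero [simp]: "s (0\<^sub>m m m) = 0\<^sub>m m m"
proof -
  have "s (0 \<cdot>\<^sub>m 0\<^sub>m m m) = 0 \<cdot>\<^sub>m s (0\<^sub>m m m)" by (rule star_smult) simp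
  then show ?thesis
    using zero_smult_mat[of "0\<^sub>m m m :: 'f mat" m m] zero_smult_mat[OF UT_carrier_mat[OF star_UT[of "0\<^sub>m m m"]]]
    by simp
qed

lemma star_eq_zero_iff: "a \<in> carrier (UT m) \<Longrightarrow> s a = 0\<^sub>m m m \<longleftrightarrow> a = 0\<^sub>m m m"
  by (metis star_star star_zero)

text \<open>The strictly upper triangular matrices are the nilpotent ones.\<close>

lemma star_strip_1:
  assumes "a \<in> strip m 1" shows "s a \<in> strip m 1"
proof -
  have a: "a \<in> carrier (UT m)" using strip_UT[OF assms] .
  \<comment> \<open>Here \<open>b\<close> is the \<open>k\<close>-th power of \<open>a\<close>. For
    \<open>k = m\<close> it is zero, so the diagonal entries of \<open>s a\<close> are nilpotent
    scalars.\<close>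
  have pow: "\<exists>b. b \<in> strip m k \<and> (\<forall>i<m. s b $$ (i, i) = (s a $$ (i, i)) ^ k)" if "k > 0" for k
    using that
  proof (induction k rule: nat_induct_non_zero)
    case 1
    then show ?case using assms by (intro exI[of _ a]) simp
  next
    case (Suc k)
    then obtain b where b: "b \<in> strip m k" "\<forall>i<m. s b $$ (i, i) = (s a $$ (i, i)) ^ k" by blast
    have "b \<in> carrier (UT m)" using strip_UT[OF b(1)] .
    then have "\<forall>i<m. s (b * a) $$ (i, i) = (s a $$ (i, i)) ^ Suc k"
      using a b(2) by (simp add: star_mult UT_diag_mult[where m = m])
    moreover have "b * a \<in> strip m (Suc k)" using strip_mult[OF b(1) assms] by simp
    ultimately show ?case by blast
  qed
  obtain b where b: "b \<in> strip m m" "\<forall>i<m. s b $$ (i, i) = (s a $$ (i, i)) ^ m"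
    using pow[OF m_pos] by blast
  have "b = 0\<^sub>m m m" using b(1) by (intro eq_matI) (auto simp: strip_def)
  then have "\<forall>i<m. s a $$ (i, i) = 0" using b(2) by auto
  then show ?thesis using star_UT[OF a] by (auto simp: strip_def UT_carrier_iff less_Suc_eq)
qed

text \<open>Superdiagonal matrix units are commutators, and commutators of homogeneous elements are
  homogeneous because the grading group is commutative.\<close>

lemma homogeneous_superdiagonal:
  assumes "Suc i < m"
  obtains g b where "b \<in> U g" "b \<in> strip m 1" "b $$ (i, Suc i) \<noteq> 0"
proof (rule ccontr)
  assume *: "\<not> thesis"
  note obt = that
  let ?f = "\<lambda>a b :: 'f mat. (a * b - b * a) $$ (i, Suc i)"
  have zero: "?f a b = 0" if "a \<in> U g" "b \<in> U h" for a b g h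
  proof -
    have "a * b \<in> U (g + h)" "b * a \<in> U (g + h)"
      using U_mult[OF that] U_mult[OF that(2,1)] by (simp_all add: add.commute)
    then have "a * b - b * a \<in> U (g + h)" by (rule U_minus)
    moreover have "a * b - b * a \<in> strip m 1"
      using that by (intro strip_commutator U_UT)
    ultimately show ?thesis using * obt by blast
  qed
  have entry: "?f a b = (\<Sum>l<m. a $$ (i, l) * b $$ (l, Suc i)) - (\<Sum>l<m. b $$ (i, l) * a $$ (l, Suc i))"
    if "a \<in> carrier (UT m)" "b \<in> carrier (UT m)" for a b :: "'f mat"
    using that assms UT_carrier_mat[OF that(1)] UT_carrier_mat[OF that(2)]
    by (simp add: index_mult_mat_sum[of _ m m])
  \<comment> \<open>The entry is bilinear in \<open>a\<close> and \<open>b\<close>, so its vanishing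
    on homogeneous pairs extends to all pairs, one argument at a time.\<close>
  have zero1: "?f a b = 0" if "a \<in> U g" "b \<in> carrier (UT m)" for a b g
  proof (rule U_induct[of b "\<lambda>x. ?f a x = 0", OF that(2)])
    show "?f a x = 0" if "x \<in> U h" for x h using zero \<open>a \<in> U g\<close> that .
    show "?f a (x + y) = 0" if "x \<in> carrier (UT m)" "y \<in> carrier (UT m)" "?f a x = 0" "?f a y = 0" for x y
      using that assms U_UT[OF \<open>a \<in> U g\<close>]
      by (simp add: entry algebra_simps sum.distrib del: index_minus_mat)
  qed
  have zero2: "?f a b = 0" if "a \<in> carrier (UT m)" "b \<in> carrier (UT m)" for a b
  proof (rule U_induct[of a "\<lambda>x. ?f x b = 0", OF that(1)])
    show "?f x b = 0" if "x \<in> U h" for x h using zero1 that \<open>b \<in> carrier (UT m)\<close> .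
    show "?f (x + y) b = 0" if "x \<in> carrier (UT m)" "y \<in> carrier (UT m)" "?f x b = 0" "?f y b = 0" for x y
      using that assms \<open>b \<in> carrier (UT m)\<close>
      by (simp add: entry algebra_simps sum.distrib del: index_minus_mat)
  qed
  have "?f (mat_unit m i i) (mat_unit m i (Suc i)) = 1"
    using assms by (simp add: mat_unit_mult)
  then show False using zero2[of "mat_unit m i i" "mat_unit m i (Suc i)"] by simp
qed

text \<open>Homogeneous elements with nonzero superdiagonal entries are multiplied along the path
  from \<open>i\<close> to \<open>i + k\<close>. Membership of \<open>s x\<close> is carried through
  the induction, because invariance under \<open>s\<close> is so far known only for
  \<open>strip m 1\<close>.\<close>

lemma homogeneous_strip:
  assumes "i + k < m"
  obtains g x where "x \<in> U g" "x \<in> strip m k" "s x \<in> strip m k" "x $$ (i, i + k) \<noteq> 0"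
proof -
  have "\<exists>g x. x \<in> U g \<and> x \<in> strip m k \<and> s x \<in> strip m k \<and> x $$ (i, i + k) \<noteq> 0"
    using assms
  proof (induction k)
    case 0
    then show ?case using U_one by (intro exI[of _ 0] exI[of _ "1\<^sub>m m"]) (simp add: strip_0)
  next
    case (Suc k)
    then obtain g x where x: "x \<in> U g" "x \<in> strip m k" "s x \<in> strip m k" "x $$ (i, i + k) \<noteq> 0"
      by auto
    have "Suc (i + k) < m" using Suc.prems by simp
    then obtain h b where b: "b \<in> U h" "b \<in> strip m 1" "b $$ (i + k, Suc (i + k)) \<noteq> 0"
      using homogeneous_superdiagonal by metis
    have "s (x * b) \<in> strip m (Suc k)"
      using strip_mult[OF star_strip_1[OF b(2)] x(3)] U_UT[OF x(1)] U_UT[OF b(1)]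
      by (simp add: star_mult)
    moreover have "x * b \<in> strip m (Suc k)" using strip_mult[OF x(2) b(2)] by simp
    moreover have "(x * b) $$ (i, i + Suc k) \<noteq> 0"
      using strip_mult_entry[OF x(2) b(2), of i] Suc.prems x b by simp
    ultimately show ?case using U_mult[OF x(1) b(1)] by blast
  qed
  then show ?thesis using that by blast
qed

text \<open>A probe for the diagonal entry at \<open>k\<close>: the factors meet at that index, so
  by \<open>strip_sandwich\<close> inserting a matrix between them multiplies \<open>x * y\<close>
  by its entry at \<open>(k, k)\<close>. The same holds for their images under \<open>s\<close>, in
  reversed order.\<close>

lemma homogeneous_path:
  assumes "k < m"
  obtains g h x y where "x \<in> U g" "y \<in> U h" "x \<in> strip m k" "y \<in> strip m (m - 1 - k)"
    "s x \<in> strip m k" "s y \<in> strip m (m - 1 - k)" "x * y \<noteq> 0\<^sub>m m m"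
proof -
  have k: "k + (m - 1 - k) < m" using assms by simp
  obtain g x where x: "x \<in> U g" "x \<in> strip m k" "s x \<in> strip m k" "x $$ (0, 0 + k) \<noteq> 0"
    using homogeneous_strip[of 0 k] assms by (metis add_0)
  obtain h y where y: "y \<in> U h" "y \<in> strip m (m - 1 - k)" "s y \<in> strip m (m - 1 - k)"
    "y $$ (k, k + (m - 1 - k)) \<noteq> 0"
    using homogeneous_strip[of k "m - 1 - k"] k by metis
  have "(x * y) $$ (0, m - 1) \<noteq> 0"
    using strip_mult_entry[OF x(2) y(2), of 0] x(4) y(4) assms by simp
  then have "x * y \<noteq> 0\<^sub>m m m" using m_pos by auto
  then show ?thesis using that[OF x(1) y(1) x(2) y(2) x(3) y(3)] by simp
qed

text \<open>The sandwiched product has degree \<open>k + g + h\<close> and is a multiple of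
  \<open>x * y\<close>, which has degree \<open>k + h\<close>. As these degrees differ, the multiple
  is zero, while \<open>x * y\<close> is not.\<close>

lemma diagonal_zero:
  assumes "a \<in> U g" "g \<noteq> 0" "i < m"
  shows "a $$ (i, i) = 0"
proof -
  obtain k h x y where xy: "x \<in> U k" "y \<in> U h" "x \<in> strip m i" "y \<in> strip m (m - 1 - i)"
    "x * y \<noteq> 0\<^sub>m m m"
    using homogeneous_path[OF assms(3)] by metis
  have "x * a * y = a $$ (i, i) \<cdot>\<^sub>m (x * y)"
    using xy assms by (intro strip_sandwich[of _ m _ _ _ "m - 1 - i"] U_UT) auto
  moreover have "x * a * y \<in> U (k + g + h)" using U_mult[OF U_mult[OF xy(1) assms(1)] xy(2)] .
  moreover have "a $$ (i, i) \<cdot>\<^sub>m (x * y) \<in> U (k + h)" using U_smult[OF U_mult[OF xy(1,2)]] .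
  moreover have "k + g + h \<noteq> k + h" using assms(2) by simp
  ultimately have eq0: "a $$ (i, i) \<cdot>\<^sub>m (x * y) = 0\<^sub>m m m"
    using U_disjoint by simp
  have xyC: "x * y \<in> carrier_mat m m" using xy U_UT UT_carrier_mat by (intro mult_carrier_mat) blast+
  show ?thesis
    using smult_mat_cancel[OF xyC xy(5), of "a $$ (i, i)" 0] eq0 zero_smult_mat[OF xyC] by simp
qed

text \<open>Applying \<open>s\<close> to a sandwich gives a sandwich in the reversed order. Its left
  factor \<open>s y\<close> now has radical exponent \<open>m - 1 - i\<close>, so it reads the entry
  of \<open>s a\<close> at the reflected index.\<close>

lemma star_diagonal:
  assumes "a \<in> carrier (UT m)" "i < m"
  shows "s a $$ (m - 1 - i, m - 1 - i) = a $$ (i, i)"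
proof -
  let ?i = "m - 1 - i"
  obtain k h x y where xy: "x \<in> U k" "y \<in> U h" "x \<in> strip m i" "y \<in> strip m ?i"
    "s x \<in> strip m i" "s y \<in> strip m ?i" "x * y \<noteq> 0\<^sub>m m m"
    using homogeneous_path[OF assms(2)] by metis
  have x: "x \<in> carrier (UT m)" and y: "y \<in> carrier (UT m)" using xy U_UT by auto
  have "x * a * y = a $$ (i, i) \<cdot>\<^sub>m (x * y)"
    using xy assms by (intro strip_sandwich[of _ m _ _ _ ?i]) auto
  then have "s (x * a * y) = s (a $$ (i, i) \<cdot>\<^sub>m (x * y))" by simp
  then have 1: "s y * (s a * s x) = a $$ (i, i) \<cdot>\<^sub>m (s y * s x)"
    using x y assms by (simp add: star_mult star_smult)
  have "s y * s a * s x = s a $$ (?i, ?i) \<cdot>\<^sub>m (s y * s x)"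
    using xy assms by (intro strip_sandwich[of _ m _ _ _ i]) auto
  moreover have "s y * (s a * s x) = s y * s a * s x"
    using x y assms by (intro assoc_mult_mat[of _ m m, symmetric] UT_carrier_mat) auto
  ultimately have eq: "a $$ (i, i) \<cdot>\<^sub>m (s y * s x) = s a $$ (?i, ?i) \<cdot>\<^sub>m (s y * s x)"
    using 1 by simp
  have "s y * s x \<noteq> 0\<^sub>m m m"
    using star_eq_zero_iff[of "x * y"] x y xy(7) by (simp add: star_mult)
  moreover have "s y * s x \<in> carrier_mat m m" using x y by (intro UT_carrier_mat) simp
  ultimately show ?thesis using smult_mat_cancel eq by metis
qed

text \<open>Components of nonzero degree have zero diagonal, so the degree 0 component carries the
  whole diagonal.\<close>

lemma neutral_component_diagonal:
  assumes "a \<in> carrier (UT m)"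
  obtains x where "x \<in> U 0" "\<And>i. i < m \<Longrightarrow> x $$ (i, i) = a $$ (i, i)"
proof -
  have "\<exists>x\<in>U 0. \<forall>i<m. x $$ (i, i) = a $$ (i, i)"
    using assms
  proof (rule U_induct)
    fix g x assume x: "x \<in> U g"
    show "\<exists>y\<in>U 0. \<forall>i<m. y $$ (i, i) = x $$ (i, i)"
    proof (cases "g = 0")
      case False
      then show ?thesis using diagonal_zero[OF x] by (intro bexI[OF _ U_zero]) auto
    qed (use x in auto)
  next
    fix x y assume "x \<in> carrier (UT m)" "y \<in> carrier (UT m)"
      and "\<exists>z\<in>U 0. \<forall>i<m. z $$ (i, i) = x $$ (i, i)" "\<exists>z\<in>U 0. \<forall>i<m. z $$ (i, i) = y $$ (i, i)"
    then obtain x' y' where "x' \<in> U 0" "y' \<in> U 0" "\<forall>i<m. x' $$ (i, i) = x $$ (i, i)"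
      "\<forall>i<m. y' $$ (i, i) = y $$ (i, i)" by blast
    with \<open>x \<in> _\<close> \<open>y \<in> _\<close> show "\<exists>z\<in>U 0. \<forall>i<m. z $$ (i, i) = (x + y) $$ (i, i)"
      by (intro bexI[of _ "x' + y'"]) (auto simp: U_add U_UT)
  qed
  then show ?thesis using that by blast
qed

text \<open>The diagonal of \<open>s x\<close> is the reversed diagonal of \<open>x\<close>. If that
  diagonal is antisymmetric, passing to the skew part, half of \<open>x - s x\<close>, leaves it
  unchanged.\<close>

lemma neutral_skew:
  assumes two: "(2 :: 'f) \<noteq> 0" and \<delta>: "\<And>i. i < m \<Longrightarrow> \<delta> (m - 1 - i) = - \<delta> i"
  obtains d where "d \<in> U 0" "s d = (-1) \<cdot>\<^sub>m d" "\<And>i. i < m \<Longrightarrow> d $$ (i, i) = \<delta> i"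
proof -
  let ?a = "mat m m (\<lambda>(i, j). if i = j then \<delta> i else 0)"
  have "?a \<in> carrier (UT m)" by (auto simp: UT_carrier_iff)
  then obtain x where x: "x \<in> U 0" "\<And>i. i < m \<Longrightarrow> x $$ (i, i) = \<delta> i"
    by (rule neutral_component_diagonal) auto
  have xC: "x \<in> carrier (UT m)" using U_UT x by blast
  let ?d = "(1 / 2) \<cdot>\<^sub>m (x - s x)"
  have sd: "s ?d = (1 / 2) \<cdot>\<^sub>m (s x - x)"
    using xC by (simp add: star_smult star_minus)
  show ?thesis
  proof (rule that[of ?d])
    show "?d \<in> U 0" using x star_U by (intro U_smult U_minus)
    show "s ?d = (-1) \<cdot>\<^sub>m ?d"
      unfolding sd by (rule eq_matI) (use xC star_UT[OF xC] in \<open>auto simp: algebra_simps\<close>)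
    fix i assume i: "i < m"
    have "s x $$ (i, i) = - \<delta> i"
      using star_diagonal[OF xC, of "m - 1 - i"] x(2)[of "m - 1 - i"] \<delta>[OF i] i by simp
    then show "?d $$ (i, i) = \<delta> i"
      using x(2)[OF i] two i xC star_UT[OF xC] by simp
  qed
qed

end

subsection \<open>Diagonalization\<close>

text \<open>Over a finite field the product of all X - a vanishes everywhere, so adding 1 gives a
  nonconstant polynomial without a root.\<close>

lemma infinite_alg_closed_field: "infinite (UNIV :: 'f :: alg_closed_field set)"
proof
  assume fin: "finite (UNIV :: 'f set)"
  let ?q = "\<Prod>x\<in>(UNIV :: 'f set). [:-x, 1:]"
  have deg: "degree ?q = card (UNIV :: 'f set)"
    by (subst degree_prod_sum_eq) auto
  have "card (UNIV :: 'f set) > 0" using fin by (simp add: card_gt_0_iff)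
  moreover have "degree (?q + 1) = degree ?q"
    using calculation deg by (intro degree_add_eq_left) simp
  ultimately obtain y where "poly (?q + 1) y = 0"
    using alg_closed_imp_poly_has_root[of "?q + 1"] deg by auto
  moreover have "poly ?q y = 0" using fin by (simp add: poly_prod)
  ultimately show False by simp
qed

text \<open>Square roots of distinct nonzero elements remain distinct up to sign, since their
  squares separate them; a root differs from its own negative because 2 is not zero.\<close>

lemma exists_antisymmetric_values:
  assumes two: "(2 :: 'f :: alg_closed_field) \<noteq> 0"
  obtains \<delta> :: "nat \<Rightarrow> 'f :: alg_closed_field" where "inj_on \<delta> {..<m}" "\<And>i. i < m \<Longrightarrow> \<delta> (m - 1 - i) = - \<delta> i"
proof -
  have "infinite (UNIV - {0 :: 'f})" using infinite_alg_closed_field by simp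
  then obtain f :: "nat \<Rightarrow> 'f" where f: "inj f" "range f \<subseteq> UNIV - {0}"
    using infinite_countable_subset by blast
  have "\<forall>n. \<exists>y. y ^ 2 = f n" by (intro allI nth_root_exists) simp
  then obtain r where r: "\<And>n. r n ^ 2 = f n" by metis
  have nz: "r n \<noteq> 0" for n using f(2) r[of n] by (auto simp: image_subset_iff)
  have eq: "r n = r k \<longleftrightarrow> n = k" for n k using injD[OF f(1), of n k] r[of n] r[of k] by metis
  have neq: "r n \<noteq> - r k" for n k
  proof
    assume *: "r n = - r k"
    have "f n = f k" unfolding r[symmetric] * by simp
    then have nk: "n = k" by (rule injD[OF f(1)])
    have "r n + r k = 0" unfolding * by simp
    then have "2 * r k = 0" unfolding nk by (simp only: mult_2)
    then show False using two nz[of k] by simp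
  qed
  \<comment> \<open>The middle index, present when \<open>m\<close> is odd, is its own reflection,
    so its value must be 0. This is why the roots are chosen nonzero.\<close>
  define \<delta> where "\<delta> i = (if i < m - 1 - i then r i else if m - 1 - i < i then - r (m - 1 - i) else 0)" for i
  have \<delta>: "i < m - 1 - i \<Longrightarrow> \<delta> i = r i" "m - 1 - i < i \<Longrightarrow> \<delta> i = - r (m - 1 - i)"
    "i = m - 1 - i \<Longrightarrow> \<delta> i = 0" for i
    unfolding \<delta>_def by simp_all
  have inj: "i = j" if ij: "i < m" "j < m" "\<delta> i = \<delta> j" for i j
  proof -
    consider "i < m - 1 - i" | "m - 1 - i < i" | "i = m - 1 - i" by linarith
    note i_cases = this
    consider "j < m - 1 - j" | "m - 1 - j < j" | "j = m - 1 - j" by linarith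
    note j_cases = this
    show ?thesis
    proof (rule i_cases)
      assume i: "i < m - 1 - i"
      note \<delta>i = \<delta>(1)[OF i, unfolded ij(3)]
      show ?thesis
      proof (rule j_cases)
        assume "j < m - 1 - j"
        then show ?thesis using \<delta>i \<delta>(1) eq by metis
      next
        assume "m - 1 - j < j"
        then show ?thesis using \<delta>i \<delta>(2) neq by metis
      next
        assume "j = m - 1 - j"
        then show ?thesis using \<delta>i \<delta>(3) nz by metis
      qed
    next
      assume i: "m - 1 - i < i"
      note \<delta>i = \<delta>(2)[OF i, unfolded ij(3)]
      show ?thesis
      proof (rule j_cases)
        assume "j < m - 1 - j"
        then show ?thesis using \<delta>i \<delta>(1) neq by metis
      next
        assume j: "m - 1 - j < j"
        have "r (m - 1 - i) = r (m - 1 - j)" using \<delta>i \<delta>(2)[OF j] by (simp only: neg_equal_iff_equal)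
        then have "m - 1 - i = m - 1 - j" by (simp only: eq)
        then show ?thesis using ij by linarith
      next
        assume "j = m - 1 - j"
        then show ?thesis using \<delta>i \<delta>(3) nz neg_equal_0_iff_equal by metis
      qed
    next
      assume i: "i = m - 1 - i"
      note \<delta>i = \<delta>(3)[OF i, unfolded ij(3)]
      show ?thesis
      proof (rule j_cases)
        assume "j < m - 1 - j"
        then show ?thesis using \<delta>i \<delta>(1) nz by metis
      next
        assume "m - 1 - j < j"
        then show ?thesis using \<delta>i \<delta>(2) nz neg_equal_0_iff_equal by metis
      next
        assume "j = m - 1 - j"
        then show ?thesis using i by linarith
      qed
    qed
  qed
  show ?thesis
  proof (rule that[of \<delta>])
    show "inj_on \<delta> {..<m}" by (rule inj_onI) (use inj in auto)
    fix i assume "i < m"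
    consider "i < m - 1 - i" | "m - 1 - i < i" | "i = m - 1 - i" by linarith
    then show "\<delta> (m - 1 - i) = - \<delta> i"
      unfolding \<delta>_def using \<open>i < m\<close> by cases auto
  qed
qed

text \<open>The determinant yields an inverse among all matrices; that it is triangular has to be
  shown, since conjugation must stay inside the algebra.\<close>

lemma UT_inverse:
  fixes P :: "'f :: field mat"
  assumes P: "P \<in> carrier (UT m)" and diag: "\<And>i. i < m \<Longrightarrow> P $$ (i, i) \<noteq> 0"
  obtains Q where "Q \<in> carrier (UT m)" "P * Q = 1\<^sub>m m" "Q * P = 1\<^sub>m m"
proof -
  have PC: "P \<in> carrier_mat m m" using UT_carrier_mat[OF P] .
  have "det P = prod_list (diag_mat P)"
    using P by (intro det_upper_triangular) (auto simp: UT_simps)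
  also have "\<dots> \<noteq> 0" using diag P by (auto simp: prod_list_zero_iff diag_mat_def)
  finally obtain Q where Q: "Q \<in> carrier_mat m m" "P * Q = 1\<^sub>m m" "Q * P = 1\<^sub>m m"
    using det_non_zero_imp_unit[OF PC, of "()"] by (auto simp: Units_def ring_mat_def)
  \<comment> \<open>Induction on the column: below the diagonal, the entry of \<open>Q * P\<close>
    reduces to the entry of \<open>Q\<close> times the pivot of \<open>P\<close> at
    \<open>(j, j)\<close>, and it must be 0.\<close>
  have "Q $$ (i, j) = 0" if "i < m" "j < i" for i j
    using that(2)
  proof (induction j rule: less_induct)
    case (less j)
    have "(Q * P) $$ (i, j) = (\<Sum>l<m. Q $$ (i, l) * P $$ (l, j))"
      using that less.prems by (intro index_mult_mat_sum[OF Q(1) PC]) auto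
    also have "\<dots> = (\<Sum>l\<in>{j}. Q $$ (i, l) * P $$ (l, j))"
    proof (rule sum.mono_neutral_right)
      show "\<forall>l\<in>{..<m} - {j}. Q $$ (i, l) * P $$ (l, j) = 0"
      proof
        fix l assume l: "l \<in> {..<m} - {j}"
        show "Q $$ (i, l) * P $$ (l, j) = 0"
          using less.IH[of l] less.prems l P by (cases "l < j") (auto simp: UT_carrier_iff)
      qed
    qed (use that less.prems in auto)
    finally show ?case using Q(3) that less.prems diag[of j] by simp
  qed
  then have "Q \<in> carrier (UT m)" using Q(1) by (simp add: UT_carrier_iff)
  then show ?thesis using that Q by blast
qed

definition diagonal :: "nat \<Rightarrow> (nat \<Rightarrow> 'f) \<Rightarrow> 'f :: field mat" where
  "diagonal m f = mat m m (\<lambda>(i, j). if i = j then f i else 0)"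

lemma diagonal_UT [simp]: "diagonal m f \<in> carrier (UT m)"
  by (auto simp: diagonal_def UT_carrier_iff)

lemma diagonal_carrier_mat [simp]: "diagonal m f \<in> carrier_mat m m"
  by (simp add: diagonal_def)

lemma diagonal_dims [simp]: "dim_row (diagonal m f) = m" "dim_col (diagonal m f) = m"
  by (simp_all add: diagonal_def)

lemma diagonal_index [simp]:
  "i < m \<Longrightarrow> j < m \<Longrightarrow> diagonal m f $$ (i, j) = (if i = j then f i else 0)"
  by (simp add: diagonal_def)

lemma diagonal_mult_index:
  assumes "a \<in> carrier_mat m m" "i < m" "j < m"
  shows "(diagonal m f * a) $$ (i, j) = f i * a $$ (i, j)"
    and "(a * diagonal m f) $$ (i, j) = a $$ (i, j) * f j"
proof -
  have "(diagonal m f * a) $$ (i, j) = (\<Sum>l<m. diagonal m f $$ (i, l) * a $$ (l, j))"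
    using assms by (intro index_mult_mat_sum) auto
  also have "\<dots> = (\<Sum>l<m. if l = i then f i * a $$ (i, j) else 0)"
    by (rule sum.cong) (use assms in auto)
  finally show "(diagonal m f * a) $$ (i, j) = f i * a $$ (i, j)" using assms by simp
  have "(a * diagonal m f) $$ (i, j) = (\<Sum>l<m. a $$ (i, l) * diagonal m f $$ (l, j))"
    using assms by (intro index_mult_mat_sum) auto
  also have "\<dots> = (\<Sum>l<m. if l = j then a $$ (i, j) * f j else 0)"
    by (rule sum.cong) (use assms in auto)
  finally show "(a * diagonal m f) $$ (i, j) = a $$ (i, j) * f j" using assms by simp
qed

text \<open>Back substitution: \<open>eigenvector d k i\<close> is the \<open>i\<close>-th entry of an eigenvector for \<open>d k k\<close>.\<close>

function eigenvector :: "(nat \<Rightarrow> nat \<Rightarrow> 'f :: field) \<Rightarrow> nat \<Rightarrow> nat \<Rightarrow> 'f" where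
  "eigenvector d k i =
     (if i < k then (\<Sum>j\<in>{i<..k}. d i j * eigenvector d k j) / (d k k - d i i)
      else if i = k then 1 else 0)"
  by auto
termination by (relation "measure (\<lambda>(d, k, i). k - i)") auto

declare eigenvector.simps [simp del]

lemma eigenvector_simps:
  "k < i \<Longrightarrow> eigenvector d k i = 0" "eigenvector d k k = 1"
  "i < k \<Longrightarrow> eigenvector d k i =
     (\<Sum>j\<in>{i<..k}. d i j * eigenvector d k j) / (d k k - d i i)"
  by (simp_all add: eigenvector.simps[of d k i] eigenvector.simps[of d k k])

text \<open>The eigenvectors form the columns of an upper triangular matrix with ones on the
  diagonal. Distinct diagonal entries of \<open>d\<close> keep the denominators of the back
  substitution nonzero.\<close>

lemma UT_diagonalize:
  fixes d :: "'f :: field mat"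
  assumes d: "d \<in> carrier (UT m)" and inj: "inj_on (\<lambda>i. d $$ (i, i)) {..<m}"
  obtains P Q where "P \<in> carrier (UT m)" "Q \<in> carrier (UT m)" "P * Q = 1\<^sub>m m" "Q * P = 1\<^sub>m m"
    "Q * d * P = diagonal m (\<lambda>i. d $$ (i, i))"
proof -
  let ?d = "\<lambda>i j. d $$ (i, j)"
  let ?D = "diagonal m (\<lambda>i. d $$ (i, i))"
  let ?P = "mat m m (\<lambda>(i, k). eigenvector ?d k i)"
  have P: "?P \<in> carrier (UT m)" by (auto simp: UT_carrier_iff eigenvector_simps(1))
  obtain Q where Q: "Q \<in> carrier (UT m)" "?P * Q = 1\<^sub>m m" "Q * ?P = 1\<^sub>m m"
    by (rule UT_inverse[OF P]) (auto simp: eigenvector_simps(2))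
  have "d * ?P = ?P * ?D"
  proof (rule eq_matI)
    fix i k assume "i < dim_row (?P * ?D)" "k < dim_col (?P * ?D)"
    then have ik: "i < m" "k < m" by auto
    have sub: "(d * ?P) $$ (i, k) = (\<Sum>j\<in>{i..k}. ?d i j * eigenvector ?d k j)"
    proof -
      have "(d * ?P) $$ (i, k) = (\<Sum>j<m. ?d i j * ?P $$ (j, k))"
        using ik UT_carrier_mat[OF d] by (intro index_mult_mat_sum) auto
      also have "\<dots> = (\<Sum>j<m. ?d i j * eigenvector ?d k j)"
        by (rule sum.cong) (use ik in auto)
      also have "\<dots> = (\<Sum>j\<in>{i..k}. ?d i j * eigenvector ?d k j)"
        by (rule sum.mono_neutral_right)
          (use ik d in \<open>auto simp: UT_carrier_iff eigenvector_simps(1) not_le\<close>)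
      finally show ?thesis .
    qed
    have "(\<Sum>j\<in>{i..k}. ?d i j * eigenvector ?d k j) = eigenvector ?d k i * ?d k k"
    proof (cases "i < k")
      case True
      have "?d k k \<noteq> ?d i i" using inj_onD[OF inj, of k i] ik True by auto
      then have "(\<Sum>j\<in>{i<..k}. ?d i j * eigenvector ?d k j) = eigenvector ?d k i * (?d k k - ?d i i)"
        using True by (simp add: eigenvector_simps(3)[OF True])
      moreover have "{i..k} = insert i {i<..k}" using True by auto
      ultimately show ?thesis by (simp add: algebra_simps)
    next
      case False
      then show ?thesis by (cases "i = k") (auto simp: eigenvector_simps(1,2))
    qed
    then show "(d * ?P) $$ (i, k) = (?P * ?D) $$ (i, k)"
      using ik by (simp add: sub diagonal_mult_index)
  qed (use d in auto)
  moreover have "Q * d * ?P = Q * (d * ?P)"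
    using P Q d by (intro UT_assoc)
  ultimately have "Q * d * ?P = Q * (?P * ?D)" by simp
  also have "\<dots> = Q * ?P * ?D"
    using P Q using P Q by (intro UT_assoc[symmetric]) auto
  finally show ?thesis using that[OF P Q] by (simp add: Q(3))
qed

subsection \<open>Homogeneous matrix units\<close>

lemma UT_distrib:
  assumes "a \<in> carrier (UT m)" "b \<in> carrier (UT m)" "c \<in> carrier (UT m)"
  shows "(a + b) * c = a * c + b * c" "c * (a + b) = c * a + c * b"
  using add_mult_distrib_mat[OF assms[THEN UT_carrier_mat]]
    mult_add_distrib_mat[OF assms(3,1,2)[THEN UT_carrier_mat]] by simp_all

lemma UT_smult_mult:
  assumes "a \<in> carrier (UT m)" "b \<in> carrier (UT m)"
  shows "(x \<cdot>\<^sub>m a) * b = x \<cdot>\<^sub>m (a * b)" "a * (x \<cdot>\<^sub>m b) = x \<cdot>\<^sub>m (a * b)"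
  using mult_smult_assoc_mat[OF assms[THEN UT_carrier_mat]]
    mult_smult_distrib[OF assms[THEN UT_carrier_mat]] by simp_all

text \<open>Serves for changes of coordinates, for rescalings and for the final isomorphism. One
  size suffices, because an isomorphism is constructed only after the two sizes are known to
  agree.\<close>

definition UT_endomorphism :: "nat \<Rightarrow> ('f::field mat \<Rightarrow> 'f mat) \<Rightarrow> bool" where
  "UT_endomorphism m \<psi> \<longleftrightarrow>
     (\<forall>a\<in>carrier (UT m). \<psi> a \<in> carrier (UT m)) \<and>
     (\<forall>a\<in>carrier (UT m). \<forall>b\<in>carrier (UT m). \<psi> (a * b) = \<psi> a * \<psi> b) \<and>
     (\<forall>a\<in>carrier (UT m). \<forall>b\<in>carrier (UT m). \<psi> (a + b) = \<psi> a + \<psi> b) \<and>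
     (\<forall>c. \<forall>a\<in>carrier (UT m). \<psi> (c \<cdot>\<^sub>m a) = c \<cdot>\<^sub>m \<psi> a) \<and>
     \<psi> (1\<^sub>m m) = 1\<^sub>m m"

lemma UT_endomorphismD:
  assumes "UT_endomorphism m \<psi>"
  shows "a \<in> carrier (UT m) \<Longrightarrow> \<psi> a \<in> carrier (UT m)"
    and "a \<in> carrier (UT m) \<Longrightarrow> b \<in> carrier (UT m) \<Longrightarrow> \<psi> (a * b) = \<psi> a * \<psi> b"
    and "a \<in> carrier (UT m) \<Longrightarrow> b \<in> carrier (UT m) \<Longrightarrow> \<psi> (a + b) = \<psi> a + \<psi> b"
    and "a \<in> carrier (UT m) \<Longrightarrow> \<psi> (c \<cdot>\<^sub>m a) = c \<cdot>\<^sub>m \<psi> a"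
    and "\<psi> (1\<^sub>m m) = 1\<^sub>m m"
    and "\<psi> (0\<^sub>m m m) = 0\<^sub>m m m"
proof -
  note D = assms[unfolded UT_endomorphism_def]
  show "a \<in> carrier (UT m) \<Longrightarrow> \<psi> a \<in> carrier (UT m)"
    "a \<in> carrier (UT m) \<Longrightarrow> b \<in> carrier (UT m) \<Longrightarrow> \<psi> (a * b) = \<psi> a * \<psi> b"
    "a \<in> carrier (UT m) \<Longrightarrow> b \<in> carrier (UT m) \<Longrightarrow> \<psi> (a + b) = \<psi> a + \<psi> b"
    "a \<in> carrier (UT m) \<Longrightarrow> \<psi> (c \<cdot>\<^sub>m a) = c \<cdot>\<^sub>m \<psi> a"
    "\<psi> (1\<^sub>m m) = 1\<^sub>m m"
    using D by blast+
  have "\<psi> (0 \<cdot>\<^sub>m 0\<^sub>m m m) = 0 \<cdot>\<^sub>m \<psi> (0\<^sub>m m m)" using D UT_one_zero by blast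
  moreover have "\<psi> (0\<^sub>m m m) \<in> carrier_mat m m" using D UT_one_zero UT_carrier_mat by blast
  ultimately show "\<psi> (0\<^sub>m m m) = 0\<^sub>m m m"
    using zero_smult_mat[of "0\<^sub>m m m :: 'a mat" m m] zero_smult_mat[of "\<psi> (0\<^sub>m m m)" m m] by simp
qed

lemma UT_conjugation:
  assumes P: "P \<in> carrier (UT m)" and Q: "Q \<in> carrier (UT m)" and QP: "Q * P = 1\<^sub>m m"
    and PQ: "P * Q = 1\<^sub>m m"
  shows "UT_endomorphism m (\<lambda>a. P * a * Q)"
proof -
  have "P * (a * b) * Q = P * a * Q * (P * b * Q)"
    if a: "a \<in> carrier (UT m)" and b: "b \<in> carrier (UT m)" for a b
  proof -
    have "P * a * Q * (P * b * Q) = P * a * (Q * P) * (b * Q)"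
      using P Q a b by (simp add: UT_assoc[where m = m])
    also have "\<dots> = P * (a * b) * Q"
      using P Q a b UT_carrier_mat[of "P * a" m] by (simp add: QP UT_assoc[where m = m])
    finally show ?thesis ..
  qed
  then show ?thesis
    using P Q PQ UT_carrier_mat[OF P]
    by (simp add: UT_endomorphism_def UT_distrib[where m = m] UT_smult_mult[where m = m])
qed

lemma UT_conjugation_inverse:
  assumes P: "P \<in> carrier (UT m)" and Q: "Q \<in> carrier (UT m)" and QP: "Q * P = 1\<^sub>m m"
    and a: "a \<in> carrier (UT m)"
  shows "Q * (P * a * Q) * P = a"
proof -
  have "Q * (P * a * Q) * P = (Q * P) * a * (Q * P)"
    using P Q a by (simp add: UT_assoc[where m = m])
  then show ?thesis using QP UT_carrier_mat[OF a] by simp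
qed

context UT_graded_star
begin

text \<open>Conjugation by the matrix of eigenvectors and its inverse is packaged as a pair of
  mutually inverse endomorphisms; later arguments refer to the pair and not to the matrices.\<close>

lemma skew_diagonalizable:
  assumes two: "(2 :: 'f) \<noteq> 0"
  obtains \<delta> d \<psi> \<chi> where "inj_on \<delta> {..<m}" "\<And>i. i < m \<Longrightarrow> \<delta> (m - 1 - i) = - \<delta> i"
    "d \<in> U 0" "s d = (-1) \<cdot>\<^sub>m d" "\<psi> (diagonal m \<delta>) = d"
    "UT_endomorphism m \<psi>" "UT_endomorphism m \<chi>"
    "\<And>a. a \<in> carrier (UT m) \<Longrightarrow> \<psi> (\<chi> a) = a" "\<And>a. a \<in> carrier (UT m) \<Longrightarrow> \<chi> (\<psi> a) = a"
proof -
  obtain \<delta> :: "nat \<Rightarrow> 'f" where \<delta>: "inj_on \<delta> {..<m}" "\<And>i. i < m \<Longrightarrow> \<delta> (m - 1 - i) = - \<delta> i"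
    using exists_antisymmetric_values[where m = m, OF two] by blast
  obtain d where d: "d \<in> U 0" "s d = (-1) \<cdot>\<^sub>m d" "\<And>i. i < m \<Longrightarrow> d $$ (i, i) = \<delta> i"
    using neutral_skew[where \<delta> = \<delta>, OF two \<delta>(2)] by blast
  have dC: "d \<in> carrier (UT m)" using U_UT[OF d(1)] .
  have inj: "inj_on (\<lambda>i. d $$ (i, i)) {..<m}"
    using inj_on_cong[of "{..<m}" "\<lambda>i. d $$ (i, i)" \<delta>] \<delta>(1) d(3) by blast
  obtain P Q where PQ: "P \<in> carrier (UT m)" "Q \<in> carrier (UT m)" "P * Q = 1\<^sub>m m"
    "Q * P = 1\<^sub>m m" "Q * d * P = diagonal m (\<lambda>i. d $$ (i, i))"
    by (rule UT_diagonalize[OF dC inj])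
  have eq: "diagonal m (\<lambda>i. d $$ (i, i)) = diagonal m \<delta>"
    by (rule eq_matI) (use d(3) in auto)
  show ?thesis
  proof (rule that[OF \<delta> d(1,2)])
    show "P * diagonal m \<delta> * Q = d"
      unfolding eq[symmetric] PQ(5)[symmetric]
      by (rule UT_conjugation_inverse[OF PQ(2,1,3) dC])
    show "UT_endomorphism m (\<lambda>a. P * a * Q)" "UT_endomorphism m (\<lambda>a. Q * a * P)"
      using PQ by (auto intro: UT_conjugation)
    show "P * (Q * a * P) * Q = a" "Q * (P * a * Q) * P = a" if "a \<in> carrier (UT m)" for a
      using UT_conjugation_inverse[OF PQ(2,1,3) that] UT_conjugation_inverse[OF PQ(1,2,4) that] .
  qed
qed

text \<open>The idempotents are Lagrange interpolation polynomials in \<open>d\<close>.\<close>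

lemma idempotent_homogeneous:
  assumes \<psi>: "UT_endomorphism m \<psi>" and \<delta>: "inj_on \<delta> {..<m}" "\<psi> (diagonal m \<delta>) \<in> U 0"
    and k: "k < m"
  shows "\<psi> (mat_unit m k k) \<in> U 0"
proof -
  note \<psi>D = UT_endomorphismD[OF \<psi>]
  \<comment> \<open>\<open>U 0\<close> is a subalgebra containing the identity and
    \<open>\<psi> (diagonal m \<delta>)\<close>, hence every product of their differences with
    scalar coefficients \<open>\<delta> l\<close>.\<close>
  have U0: "\<psi> (diagonal m (\<lambda>i. \<Prod>l\<in>S. \<delta> i - \<delta> l)) \<in> U 0" if "finite S" for S
    using that
  proof (induction S)
    case empty
    have "diagonal m (\<lambda>i. \<Prod>l\<in>{}. \<delta> i - \<delta> l) = 1\<^sub>m m" by (rule eq_matI) auto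
    then show ?case using U_one \<psi>D(5) by simp
  next
    case (insert k S)
    let ?f = "\<lambda>i. \<Prod>l\<in>S. \<delta> i - \<delta> l"
    have "diagonal m (\<lambda>i. \<Prod>l\<in>insert k S. \<delta> i - \<delta> l)
        = diagonal m ?f * (diagonal m \<delta> + (- \<delta> k) \<cdot>\<^sub>m 1\<^sub>m m)"
      by (rule eq_matI) (use insert.hyps in \<open>auto simp: diagonal_mult_index mult.commute\<close>)
    then have "\<psi> (diagonal m (\<lambda>i. \<Prod>l\<in>insert k S. \<delta> i - \<delta> l))
        = \<psi> (diagonal m ?f) * (\<psi> (diagonal m \<delta>) + (- \<delta> k) \<cdot>\<^sub>m 1\<^sub>m m)"
      by (simp add: \<psi>D)
    moreover have "\<psi> (diagonal m \<delta>) + (- \<delta> k) \<cdot>\<^sub>m 1\<^sub>m m \<in> U 0"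
      using \<delta>(2) U_one by (intro U_add U_smult)
    ultimately show ?case using U_mult[OF insert.IH] by fastforce
  qed
  let ?p = "\<lambda>i. \<Prod>l\<in>{..<m} - {k}. \<delta> i - \<delta> l"
  have "?p k \<noteq> 0" using \<delta>(1) k by (auto simp: inj_on_def)
  have "?p i = 0" if "i < m" "i \<noteq> k" for i using that by (auto simp: prod_zero_iff)
  then have "mat_unit m k k = inverse (?p k) \<cdot>\<^sub>m diagonal m ?p"
    using \<open>?p k \<noteq> 0\<close> by (intro eq_matI) auto
  then have "\<psi> (mat_unit m k k) = inverse (?p k) \<cdot>\<^sub>m \<psi> (diagonal m ?p)"
    by (simp add: \<psi>D)
  then show ?thesis using U_smult[OF U0] by simp
qed

text \<open>Write d for the image of \<open>diagonal m \<delta>\<close>. The unit at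
  \<open>(i, j)\<close> satisfies d F = \<delta> i F and F d = \<delta> j F. The skew d turns this
  into y d = -\<delta> i y and d y = -\<delta> j y for its image y under \<open>s\<close>. By
  antisymmetry and injectivity of \<open>\<delta>\<close> only one coordinate of y can be nonzero,
  at the reflected and swapped position.\<close>

lemma star_mat_unit:
  assumes \<delta>: "inj_on \<delta> {..<m}" "\<And>i. i < m \<Longrightarrow> \<delta> (m - 1 - i) = - \<delta> i"
    and \<psi>: "UT_endomorphism m \<psi>" and \<chi>: "UT_endomorphism m \<chi>"
    and inv: "\<And>a. a \<in> carrier (UT m) \<Longrightarrow> \<psi> (\<chi> a) = a" "\<And>a. a \<in> carrier (UT m) \<Longrightarrow> \<chi> (\<psi> a) = a"
    and d: "s (\<psi> (diagonal m \<delta>)) = (-1) \<cdot>\<^sub>m \<psi> (diagonal m \<delta>)"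
    and ij: "i \<le> j" "j < m"
  shows "\<exists>c. s (\<psi> (mat_unit m i j)) = c \<cdot>\<^sub>m \<psi> (mat_unit m (m - 1 - j) (m - 1 - i))"
proof -
  note \<psi>D = UT_endomorphismD[OF \<psi>] and \<chi>D = UT_endomorphismD[OF \<chi>]
  let ?D = "diagonal m \<delta>" and ?E = "mat_unit m i j :: 'f mat"
  let ?y = "s (\<psi> ?E)"
  let ?h = "\<chi> ?y"
  have E: "?E \<in> carrier (UT m)" using ij by simp
  have y: "?y \<in> carrier (UT m)" using E \<psi>D(1) by simp
  have h: "?h \<in> carrier (UT m)" using y \<chi>D(1) by simp
  have hM: "?h \<in> carrier_mat m m" using UT_carrier_mat[OF h] .
  have \<psi>d: "\<psi> ?D \<in> carrier (UT m)" using \<psi>D(1) by simp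
  have DE: "?D * ?E = \<delta> i \<cdot>\<^sub>m ?E" "?E * ?D = \<delta> j \<cdot>\<^sub>m ?E"
    by (rule eq_matI; auto simp: diagonal_mult_index)+
  have "s (\<psi> (?D * ?E)) = ?y * ((-1) \<cdot>\<^sub>m \<psi> ?D)"
    using E \<psi>D \<psi>d d by (simp add: star_mult)
  then have "\<delta> i \<cdot>\<^sub>m ?y = (-1) \<cdot>\<^sub>m (?y * \<psi> ?D)"
    using E y \<psi>d \<psi>D(1)[OF E] by (simp add: DE \<psi>D(4) star_smult UT_smult_mult[where m = m])
  then have "\<chi> (\<delta> i \<cdot>\<^sub>m ?y) = \<chi> ((-1) \<cdot>\<^sub>m (?y * \<psi> ?D))" by simp
  then have 1: "\<delta> i \<cdot>\<^sub>m ?h = (-1) \<cdot>\<^sub>m (?h * ?D)"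
    using y \<psi>d by (simp add: \<chi>D inv(2))
  have "s (\<psi> (?E * ?D)) = ((-1) \<cdot>\<^sub>m \<psi> ?D) * ?y"
    using E \<psi>D \<psi>d d by (simp add: star_mult)
  then have "\<delta> j \<cdot>\<^sub>m ?y = (-1) \<cdot>\<^sub>m (\<psi> ?D * ?y)"
    using E y \<psi>d \<psi>D(1)[OF E] by (simp add: DE \<psi>D(4) star_smult UT_smult_mult[where m = m])
  then have "\<chi> (\<delta> j \<cdot>\<^sub>m ?y) = \<chi> ((-1) \<cdot>\<^sub>m (\<psi> ?D * ?y))" by simp
  then have 2: "\<delta> j \<cdot>\<^sub>m ?h = (-1) \<cdot>\<^sub>m (?D * ?h)"
    using y \<psi>d by (simp add: \<chi>D inv(2))
  have zero: "?h $$ (p, q) = 0" if pq: "p < m" "q < m" "p \<noteq> m - 1 - j \<or> q \<noteq> m - 1 - i" for p q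
  proof (rule ccontr)
    assume nz: "?h $$ (p, q) \<noteq> 0"
    have "\<delta> i * ?h $$ (p, q) = - (?h $$ (p, q) * \<delta> q)" "\<delta> j * ?h $$ (p, q) = - (\<delta> p * ?h $$ (p, q))"
      using arg_cong[OF 1, of "\<lambda>M. M $$ (p, q)"] arg_cong[OF 2, of "\<lambda>M. M $$ (p, q)"] pq hM
      by (auto simp: diagonal_mult_index)
    then have "(\<delta> i + \<delta> q) * ?h $$ (p, q) = 0" "(\<delta> j + \<delta> p) * ?h $$ (p, q) = 0"
      by (simp_all add: algebra_simps)
    then have "\<delta> q = - \<delta> i" "\<delta> p = - \<delta> j"
      using nz by (auto simp: add_eq_0_iff)
    then have "\<delta> q = \<delta> (m - 1 - i)" "\<delta> p = \<delta> (m - 1 - j)"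
      using \<delta>(2)[of i] \<delta>(2)[of j] ij by auto
    then have "q = m - 1 - i" "p = m - 1 - j"
      using pq ij by (auto intro!: inj_onD[OF \<delta>(1)])
    then show False using pq(3) by simp
  qed
  let ?c = "?h $$ (m - 1 - j, m - 1 - i)"
  have "?h = ?c \<cdot>\<^sub>m mat_unit m (m - 1 - j) (m - 1 - i)"
    by (rule eq_matI) (use zero hM in auto)
  then have "\<psi> ?h = \<psi> (?c \<cdot>\<^sub>m mat_unit m (m - 1 - j) (m - 1 - i))" by simp
  then have "?y = ?c \<cdot>\<^sub>m \<psi> (mat_unit m (m - 1 - j) (m - 1 - i))"
    using y ij by (simp add: inv(1) \<psi>D(4))
  then show ?thesis by blast
qed

end

text \<open>\<open>\<psi>\<close> carries the standard matrix units to homogeneous ones, and \<open>\<chi> a\<close> is the matrix of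
  coordinates of \<open>a\<close> with respect to them.\<close>

locale UT_homogeneous_units = UT_graded_star m U s
  for m :: nat and U :: "'g :: ab_group_add \<Rightarrow> 'f :: alg_closed_field mat set" and s +
  fixes \<psi> \<chi> :: "'f mat \<Rightarrow> 'f mat" and deg :: "nat \<Rightarrow> nat \<Rightarrow> 'g" and c :: "nat \<Rightarrow> nat \<Rightarrow> 'f"
  assumes \<psi>: "UT_endomorphism m \<psi>" and \<chi>: "UT_endomorphism m \<chi>"
    and \<psi>_\<chi>: "a \<in> carrier (UT m) \<Longrightarrow> \<psi> (\<chi> a) = a"
    and \<chi>_\<psi>: "a \<in> carrier (UT m) \<Longrightarrow> \<chi> (\<psi> a) = a"
    and unit_deg: "i \<le> j \<Longrightarrow> j < m \<Longrightarrow> \<psi> (mat_unit m i j) \<in> U (deg i j)"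
    and star_unit: "i \<le> j \<Longrightarrow> j < m \<Longrightarrow>
      s (\<psi> (mat_unit m i j)) = c i j \<cdot>\<^sub>m \<psi> (mat_unit m (m - 1 - j) (m - 1 - i))"

text \<open>Some homogeneous \<open>x\<close> has a nonzero coordinate at \<open>(i, j)\<close>,
  since these elements span the algebra. Cutting it out with the two diagonal idempotents, which
  have degree 0, preserves the degree and leaves a nonzero multiple of the unit.\<close>

lemma (in UT_graded_star) homogeneous_units_exist:
  assumes two: "(2 :: 'f) \<noteq> 0"
  shows "\<exists>\<psi> \<chi> deg c. UT_homogeneous_units m U s \<psi> \<chi> deg c"
proof -
  obtain \<delta> d \<psi> \<chi> where \<delta>: "inj_on \<delta> {..<m}" "\<And>i. i < m \<Longrightarrow> \<delta> (m - 1 - i) = - \<delta> i"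
    and d: "d \<in> U 0" "s d = (-1) \<cdot>\<^sub>m d" "\<psi> (diagonal m \<delta>) = d"
    and \<psi>: "UT_endomorphism m \<psi>" and \<chi>: "UT_endomorphism m \<chi>"
    and inv: "\<And>a. a \<in> carrier (UT m) \<Longrightarrow> \<psi> (\<chi> a) = a" "\<And>a. a \<in> carrier (UT m) \<Longrightarrow> \<chi> (\<psi> a) = a"
    using skew_diagonalizable[OF two] by metis
  note \<psi>D = UT_endomorphismD[OF \<psi>] and \<chi>D = UT_endomorphismD[OF \<chi>]
  have "\<exists>g. \<psi> (mat_unit m i j) \<in> U g" if ij: "i \<le> j" "j < m" for i j
  proof -
    have "\<exists>g. \<exists>x\<in>U g. \<chi> x $$ (i, j) \<noteq> 0"
    proof (rule ccontr)
      assume *: "\<not> ?thesis"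
      have "\<chi> (\<psi> (mat_unit m i j)) $$ (i, j) = 0"
      proof (rule U_induct[of "\<psi> (mat_unit m i j)" "\<lambda>a. \<chi> a $$ (i, j) = 0"])
        show "\<psi> (mat_unit m i j) \<in> carrier (UT m)" using ij \<psi>D(1) by simp
        show "\<chi> x $$ (i, j) = 0" if "x \<in> U g" for x g using * that by blast
        show "\<chi> (x + y) $$ (i, j) = 0"
          if "x \<in> carrier (UT m)" "y \<in> carrier (UT m)" "\<chi> x $$ (i, j) = 0" "\<chi> y $$ (i, j) = 0" for x y
          using that ij \<chi>D(1)[OF that(1)] \<chi>D(1)[OF that(2)] by (simp add: \<chi>D(3))
      qed
      then show False using ij by (simp add: inv)
    qed
    then obtain g x where x: "x \<in> U g" "\<chi> x $$ (i, j) \<noteq> 0" by blast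
    have xC: "x \<in> carrier (UT m)" "\<chi> x \<in> carrier (UT m)" using U_UT[OF x(1)] \<chi>D(1) by auto
    have idem: "\<psi> (mat_unit m k k) \<in> U 0" if "k < m" for k
      using idempotent_homogeneous[OF \<psi> \<delta>(1) _ that] d by simp
    have "\<psi> (mat_unit m i i) * x * \<psi> (mat_unit m j j) \<in> U (0 + g + 0)"
      using idem x(1) ij by (intro U_mult) auto
    moreover have "\<psi> (mat_unit m i i) * x * \<psi> (mat_unit m j j)
        = \<psi> (mat_unit m i i * \<chi> x * mat_unit m j j)"
      using xC ij by (simp add: \<psi>D inv)
    moreover have "mat_unit m i i * \<chi> x * mat_unit m j j = \<chi> x $$ (i, j) \<cdot>\<^sub>m mat_unit m i j"
      using xC ij by (intro mat_unit_sandwich UT_carrier_mat) auto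
    ultimately have "\<chi> x $$ (i, j) \<cdot>\<^sub>m \<psi> (mat_unit m i j) \<in> U g"
      using ij by (simp add: \<psi>D(4))
    then have "inverse (\<chi> x $$ (i, j)) \<cdot>\<^sub>m (\<chi> x $$ (i, j) \<cdot>\<^sub>m \<psi> (mat_unit m i j)) \<in> U g"
      by (rule U_smult)
    moreover have "inverse a \<cdot>\<^sub>m (a \<cdot>\<^sub>m M) = M" if "a \<noteq> 0" for a and M :: "'f mat"
      by (rule eq_matI) (use that in auto)
    ultimately have "\<psi> (mat_unit m i j) \<in> U g" using x(2) by simp
    then show ?thesis by blast
  qed
  then obtain deg where deg: "\<And>i j. i \<le> j \<Longrightarrow> j < m \<Longrightarrow> \<psi> (mat_unit m i j) \<in> U (deg i j)"
    by metis
  have "\<exists>c. s (\<psi> (mat_unit m i j)) = c \<cdot>\<^sub>m \<psi> (mat_unit m (m - 1 - j) (m - 1 - i))"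
    if "i \<le> j" "j < m" for i j
    using star_mat_unit[OF \<delta> \<psi> \<chi> inv _ that] d by simp
  then obtain c where c: "\<And>i j. i \<le> j \<Longrightarrow> j < m \<Longrightarrow>
      s (\<psi> (mat_unit m i j)) = c i j \<cdot>\<^sub>m \<psi> (mat_unit m (m - 1 - j) (m - 1 - i))"
    by metis
  have "UT_homogeneous_units m U s \<psi> \<chi> deg c"
    by unfold_locales (use \<psi> \<chi> inv deg c in auto)
  then show ?thesis by blast
qed

subsection \<open>The isomorphism determined by degrees and sign\<close>

lemma one_smult_mat [simp]: "(1 :: 'f :: field) \<cdot>\<^sub>m a = a"
  by (rule eq_matI) auto

lemma smult_smult_mat: "x \<cdot>\<^sub>m (y \<cdot>\<^sub>m a) = (x * y :: 'f :: field) \<cdot>\<^sub>m a"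
  by (rule eq_matI) auto

context UT_homogeneous_units
begin

lemmas \<psi>D = UT_endomorphismD[OF \<psi>] and \<chi>D = UT_endomorphismD[OF \<chi>]

lemma unit_UT [simp]: "i \<le> j \<Longrightarrow> \<psi> (mat_unit m i j) \<in> carrier (UT m)"
  by (simp add: \<psi>D(1))

lemma unit_mult:
  assumes "i \<le> j" "j < m" "k \<le> l" "l < m"
  shows "\<psi> (mat_unit m i j) * \<psi> (mat_unit m k l)
    = (if j = k then \<psi> (mat_unit m i l) else 0\<^sub>m m m)"
  using assms \<psi>D(2)[of "mat_unit m i j" "mat_unit m k l"] by (cases "j = k") (simp_all add: mat_unit_mult \<psi>D(6))

lemma unit_nonzero:
  assumes "i \<le> j" "j < m" shows "\<psi> (mat_unit m i j) \<noteq> 0\<^sub>m m m"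
proof
  assume "\<psi> (mat_unit m i j) = 0\<^sub>m m m"
  then have "mat_unit m i j = (0\<^sub>m m m :: 'f mat)"
    using \<chi>_\<psi>[of "mat_unit m i j"] assms by (simp add: \<chi>D(6))
  then have "(mat_unit m i j :: 'f mat) $$ (i, j) = 0\<^sub>m m m $$ (i, j)" by simp
  then show False using assms by simp
qed

lemma unit_smult_cancel:
  assumes "i \<le> j" "j < m" "x \<cdot>\<^sub>m \<psi> (mat_unit m i j) = y \<cdot>\<^sub>m \<psi> (mat_unit m i j)"
  shows "x = y"
  by (rule smult_mat_cancel[OF _ unit_nonzero assms(3)]) (use assms UT_carrier_mat in auto)

lemma unit_sandwich:
  assumes "a \<in> carrier (UT m)" "i \<le> j" "j < m"
  shows "\<psi> (mat_unit m i i) * a * \<psi> (mat_unit m j j) = \<chi> a $$ (i, j) \<cdot>\<^sub>m \<psi> (mat_unit m i j)"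
proof -
  have "\<psi> (mat_unit m i i) * a * \<psi> (mat_unit m j j) = \<psi> (mat_unit m i i * \<chi> a * mat_unit m j j)"
    using assms by (simp add: \<psi>D \<chi>D(1) \<psi>_\<chi>)
  also have "mat_unit m i i * \<chi> a * mat_unit m j j = \<chi> a $$ (i, j) \<cdot>\<^sub>m mat_unit m i j"
    using assms by (intro mat_unit_sandwich UT_carrier_mat \<chi>D(1)) auto
  finally show ?thesis using assms by (simp add: \<psi>D(4))
qed

lemma deg_unique:
  assumes "i \<le> j" "j < m" "x \<cdot>\<^sub>m \<psi> (mat_unit m i j) \<in> U g" "x \<noteq> 0"
  shows "deg i j = g"
proof (rule ccontr)
  assume ne: "deg i j \<noteq> g"
  have "x \<cdot>\<^sub>m \<psi> (mat_unit m i j) \<in> U (deg i j)" using unit_deg assms by (intro U_smult)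
  then have "x \<cdot>\<^sub>m \<psi> (mat_unit m i j) = 0\<^sub>m m m" using U_disjoint[OF _ assms(3) ne] by simp
  also have "\<dots> = 0 \<cdot>\<^sub>m \<psi> (mat_unit m i j)"
    using assms by (intro zero_smult_mat[symmetric] UT_carrier_mat) simp
  finally show False using unit_smult_cancel assms by blast
qed

text \<open>The product of the units at \<open>(i, j)\<close> and \<open>(j, k)\<close> is the unit
  at \<open>(i, k)\<close>. All degrees are therefore determined by those on the
  superdiagonal.\<close>

lemma deg_add:
  assumes "i \<le> j" "j \<le> k" "k < m"
  shows "deg i k = deg i j + deg j k"
proof (rule deg_unique)
  have "\<psi> (mat_unit m i j) * \<psi> (mat_unit m j k) \<in> U (deg i j + deg j k)"
    using assms by (intro U_mult unit_deg) auto
  then show "1 \<cdot>\<^sub>m \<psi> (mat_unit m i k) \<in> U (deg i j + deg j k)"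
    using assms by (simp add: unit_mult U_smult)
qed (use assms in auto)

lemma deg_diag: "i < m \<Longrightarrow> deg i i = 0"
  using deg_add[of i i i] by simp

lemma entry_deg:
  assumes "a \<in> U g" "i \<le> j" "j < m" "\<chi> a $$ (i, j) \<noteq> 0"
  shows "deg i j = g"
proof (rule deg_unique[OF assms(2,3) _ assms(4)])
  have "\<psi> (mat_unit m i i) * a * \<psi> (mat_unit m j j) \<in> U (deg i i + g + deg j j)"
    using assms by (intro U_mult unit_deg) auto
  then show "\<chi> a $$ (i, j) \<cdot>\<^sub>m \<psi> (mat_unit m i j) \<in> U g"
    using assms U_UT[OF assms(1)] by (simp add: unit_sandwich deg_diag)
qed

text \<open>Converse of \<open>entry_deg\<close>. Together they show that \<open>U g\<close> is
  spanned by the units of degree \<open>g\<close>, so in coordinates the grading is encoded by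
  \<open>deg\<close>.\<close>

lemma homogeneousI:
  assumes a: "a \<in> carrier (UT m)"
    and deg: "\<And>i j. i \<le> j \<Longrightarrow> j < m \<Longrightarrow> \<chi> a $$ (i, j) \<noteq> 0 \<Longrightarrow> deg i j = g"
  shows "a \<in> U g"
proof -
  have "\<psi> (\<chi> a) \<in> U g"
  proof (rule UT_span_mat_unit[of "\<chi> a" m "\<lambda>x. \<psi> x \<in> U g"])
    show "\<psi> (\<chi> a $$ (i, j) \<cdot>\<^sub>m mat_unit m i j) \<in> U g" if ij: "i \<le> j" "j < m" for i j
    proof (cases "\<chi> a $$ (i, j) = 0")
      case True
      then show ?thesis
        using zero_smult_mat[of "mat_unit m i j :: 'f mat" m m] by (simp add: \<psi>D(6) U_zero)
    next
      case False
      then show ?thesis using ij unit_deg[OF ij] deg[OF ij] by (simp add: \<psi>D(4) U_smult)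
    qed
  qed (use a \<chi>D(1) in \<open>auto simp: \<psi>D U_zero U_add\<close>)
  then show ?thesis using a by (simp add: \<psi>_\<chi>)
qed

section \<open>Coefficients of the involution on the matrix units\<close>

lemma star_unit_nonzero: "i \<le> j \<Longrightarrow> j < m \<Longrightarrow> c i j \<noteq> 0"
proof
  assume ij: "i \<le> j" "j < m" and "c i j = 0"
  then have "s (\<psi> (mat_unit m i j)) = 0\<^sub>m m m"
    using zero_smult_mat[OF UT_carrier_mat[OF unit_UT[of "m - 1 - j" "m - 1 - i"]]]
    by (simp add: star_unit)
  then show False using ij unit_nonzero star_eq_zero_iff by simp
qed

text \<open>The involution reverses the product of two adjacent units, but the scalars commute.
  Hence \<open>c i j\<close> is the quotient of \<open>c 0 j\<close> by \<open>c 0 i\<close>, and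
  the first row determines all coefficients.\<close>

lemma star_coeff_mult:
  assumes "i \<le> j" "j \<le> k" "k < m"
  shows "c i k = c i j * c j k"
proof (rule unit_smult_cancel[of "m - 1 - k" "m - 1 - i"])
  let ?F = "\<lambda>i j. \<psi> (mat_unit m i j)"
  have "s (?F i j * ?F j k) = (c j k \<cdot>\<^sub>m ?F (m - 1 - k) (m - 1 - j)) * (c i j \<cdot>\<^sub>m ?F (m - 1 - j) (m - 1 - i))"
    using assms by (simp add: star_mult star_unit)
  also have "\<dots> = (c j k * c i j) \<cdot>\<^sub>m ?F (m - 1 - k) (m - 1 - i)"
    using assms by (simp add: UT_smult_mult[where m = m] unit_mult smult_smult_mat mult.commute)
  also have "c j k * c i j = c i j * c j k" by (rule mult.commute)
  finally show "c i k \<cdot>\<^sub>m ?F (m - 1 - k) (m - 1 - i) = (c i j * c j k) \<cdot>\<^sub>m ?F (m - 1 - k) (m - 1 - i)"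
    using assms by (simp add: unit_mult star_unit)
qed (use assms in auto)

lemma star_coeff_diag: "i < m \<Longrightarrow> c i i = 1"
  using star_coeff_mult[of i i i] star_unit_nonzero[of i i] by simp

text \<open>The involution squares to the identity. At the corner \<open>(0, m - 1)\<close>, which
  is its own reflection, the coefficient has square 1; this is the sign.\<close>

lemma star_coeff_reflect:
  assumes "i \<le> j" "j < m"
  shows "c i j * c (m - 1 - j) (m - 1 - i) = 1"
proof (rule unit_smult_cancel[OF assms])
  have "\<psi> (mat_unit m i j) = s (s (\<psi> (mat_unit m i j)))"
    using assms by simp
  also have "\<dots> = c i j \<cdot>\<^sub>m s (\<psi> (mat_unit m (m - 1 - j) (m - 1 - i)))"
    unfolding star_unit[OF assms] using assms by (intro star_smult) simp
  also have "s (\<psi> (mat_unit m (m - 1 - j) (m - 1 - i)))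
      = c (m - 1 - j) (m - 1 - i) \<cdot>\<^sub>m \<psi> (mat_unit m i j)"
    using star_unit[of "m - 1 - j" "m - 1 - i"] assms by simp
  finally show "(c i j * c (m - 1 - j) (m - 1 - i)) \<cdot>\<^sub>m \<psi> (mat_unit m i j) = 1 \<cdot>\<^sub>m \<psi> (mat_unit m i j)"
    by (simp add: smult_smult_mat)
qed

text \<open>When two coefficient systems have the same sign, this makes the quotients of their first
  rows symmetric under reflection. For odd \<open>m\<close> the middle index forces the sign to be
  1.\<close>

lemma star_coeff_0_reflect:
  assumes "i < m"
  shows "c 0 (m - 1 - i) = c 0 i * c 0 (m - 1)"
proof -
  have "c 0 (m - 1) = c 0 (m - 1 - i) * c (m - 1 - i) (m - 1)"
    using assms by (intro star_coeff_mult) auto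
  moreover have "c 0 i * c (m - 1 - i) (m - 1) = 1"
    using star_coeff_reflect[of 0 i] assms by simp
  ultimately show ?thesis by (simp add: mult.assoc mult.left_commute)
qed

text \<open>Coordinates are read off by sandwiching between diagonal units. The involution reflects
  these units without a scalar, because \<open>c i i = 1\<close>, and swaps the two sides of the
  sandwich.\<close>

lemma coordinate_star:
  assumes a: "a \<in> carrier (UT m)" and pq: "p \<le> q" "q < m"
  shows "\<chi> (s a) $$ (p, q) = c (m - 1 - q) (m - 1 - p) * \<chi> a $$ (m - 1 - q, m - 1 - p)"
proof (rule unit_smult_cancel[OF pq])
  let ?F = "\<lambda>i j. \<psi> (mat_unit m i j)" and ?p = "m - 1 - p" and ?q = "m - 1 - q"
  have *: "s (?F i i) = ?F (m - 1 - i) (m - 1 - i)" if "i < m" for i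
    using star_unit[of i i] star_coeff_diag that by simp
  have "s (?F ?q ?q * a * ?F ?p ?p) = ?F p p * s a * ?F q q"
    using pq a *[of ?p] *[of ?q] by (simp add: star_mult UT_assoc[where m = m])
  then have "\<chi> (s a) $$ (p, q) \<cdot>\<^sub>m ?F p q = s (\<chi> a $$ (?q, ?p) \<cdot>\<^sub>m ?F ?q ?p)"
    using pq a by (simp add: unit_sandwich)
  also have "\<dots> = (c ?q ?p * \<chi> a $$ (?q, ?p)) \<cdot>\<^sub>m ?F p q"
    using star_unit[of ?q ?p] pq by (simp add: star_smult smult_smult_mat mult.commute)
  finally show "\<chi> (s a) $$ (p, q) \<cdot>\<^sub>m ?F p q = (c ?q ?p * \<chi> a $$ (?q, ?p)) \<cdot>\<^sub>m ?F p q" .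
qed

end

lemma deg_eqI:
  assumes "UT_homogeneous_units m U s \<psi> \<chi> deg c" "UT_homogeneous_units m U' s' \<psi>' \<chi>' deg' c'"
    and "\<And>i. Suc i < m \<Longrightarrow> deg i (Suc i) = deg' i (Suc i)" and "i \<le> j" "j < m"
  shows "deg i j = deg' i j"
  using assms(4,5)
proof (induction j rule: dec_induct)
  case base
  then show ?case
    using assms(1,2)[THEN UT_homogeneous_units.deg_diag] by simp
next
  case (step j)
  then show ?case
    using UT_homogeneous_units.deg_add[OF assms(1), of i j "Suc j"]
      UT_homogeneous_units.deg_add[OF assms(2), of i j "Suc j"] assms(3)[of j] by simp
qed

lemma exists_symmetric_factorization:
  fixes \<nu> :: "nat \<Rightarrow> 'f :: alg_closed_field"
  assumes "\<And>i. i < m \<Longrightarrow> \<nu> i \<noteq> 0" "\<And>i. i < m \<Longrightarrow> \<nu> (m - 1 - i) = \<nu> i"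
  obtains \<rho> where "\<And>i. i < m \<Longrightarrow> \<rho> i \<noteq> 0" "\<And>i. i < m \<Longrightarrow> \<rho> i * \<rho> (m - 1 - i) = \<nu> i"
proof -
  have "\<exists>y. y ^ 2 = \<nu> i" for i by (rule nth_root_exists) simp
  then obtain r where r: "\<And>i. r i ^ 2 = \<nu> i" by metis
  \<comment> \<open>Each pair of reflected indices puts the whole value on its smaller member; only
    the middle index needs a square root.\<close>
  let ?\<rho> = "\<lambda>i. if i < m - 1 - i then \<nu> i else if i = m - 1 - i then r i else 1"
  show ?thesis
  proof (rule that[of ?\<rho>])
    fix i assume i: "i < m"
    have "r i \<noteq> 0" using r[of i] assms(1)[OF i] by auto
    then show "?\<rho> i \<noteq> 0" using assms(1)[OF i] by simp
    have "m - 1 - (m - 1 - i) = i" using i by simp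
    then consider "i < m - 1 - i" "\<not> m - 1 - i < m - 1 - (m - 1 - i)" "m - 1 - i \<noteq> m - 1 - (m - 1 - i)"
      | "i = m - 1 - i" | "\<not> i < m - 1 - i" "i \<noteq> m - 1 - i" "m - 1 - i < m - 1 - (m - 1 - i)"
      by linarith
    then show "?\<rho> i * ?\<rho> (m - 1 - i) = \<nu> i"
    proof cases
      case 1
      then show ?thesis by simp
    next
      case 2
      then show ?thesis using r[of i] by (metis less_irrefl power2_eq_square)
    next
      case 3
      then show ?thesis using assms(2)[OF i] by simp
    qed
  qed
qed

lemma UT_endomorphism_comp:
  "UT_endomorphism m f \<Longrightarrow> UT_endomorphism m g \<Longrightarrow> UT_endomorphism m (\<lambda>a. f (g a))"
  by (simp add: UT_endomorphism_def)

text \<open>The map sends F_ij to \<open>\<rho> i / \<rho> j\<close> times F'_ij. Comparing the two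
  involutions on F_ij, it must satisfy \<open>c i j * \<rho> j * \<rho> (m - 1 - j) = c' i j *
  \<rho> i * \<rho> (m - 1 - i)\<close>. By multiplicativity of the coefficients this holds if each
  product \<open>\<rho> i * \<rho> (m - 1 - i)\<close> equals \<open>c' 0 i / c 0 i\<close>.\<close>

lemma homogeneous_units_isomorphic:
  assumes A: "UT_homogeneous_units m U s \<psi> \<chi> deg c"
    and B: "UT_homogeneous_units m U' s' \<psi>' \<chi>' deg' c'"
    and deg: "\<And>i. Suc i < m \<Longrightarrow> deg i (Suc i) = deg' i (Suc i)"
    and c: "c 0 (m - 1) = c' 0 (m - 1)"
  shows "graded_star_isomorphic (UT m) U s (UT m) U' s'"
proof -
  interpret A: UT_homogeneous_units m U s \<psi> \<chi> deg c by fact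
  interpret B: UT_homogeneous_units m U' s' \<psi>' \<chi>' deg' c' by fact
  have nz: "c 0 i \<noteq> 0" "c' 0 i \<noteq> 0" if "i < m" for i
    using that A.star_unit_nonzero B.star_unit_nonzero by auto
  define \<nu> where "\<nu> i = c' 0 i / c 0 i" for i
  have \<nu>_nz: "\<nu> i \<noteq> 0" if "i < m" for i using nz that by (simp add: \<nu>_def)
  \<comment> \<open>Equality of the signs enters here: reflecting the index multiplies numerator and
    denominator by the same nonzero scalar.\<close>
  have \<nu>_sym: "\<nu> (m - 1 - i) = \<nu> i" if "i < m" for i
    using A.star_coeff_0_reflect[OF that] B.star_coeff_0_reflect[OF that] nz(2)[of "m - 1"] A.m_pos c
    by (simp add: \<nu>_def)
  obtain \<rho> where \<rho>: "\<And>i. i < m \<Longrightarrow> \<rho> i \<noteq> 0" "\<And>i. i < m \<Longrightarrow> \<rho> i * \<rho> (m - 1 - i) = \<nu> i"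
    using exists_symmetric_factorization[of m \<nu>] \<nu>_nz \<nu>_sym by blast
  let ?R = "diagonal m \<rho>" and ?R' = "diagonal m (\<lambda>i. inverse (\<rho> i))"
  let ?k = "\<lambda>a. ?R * a * ?R'" and ?k' = "\<lambda>a. ?R' * a * ?R"
  have RR: "?R * ?R' = 1\<^sub>m m" "?R' * ?R = 1\<^sub>m m"
    by (rule eq_matI; use \<rho>(1) in \<open>auto simp: diagonal_mult_index\<close>)+
  have k: "UT_endomorphism m ?k" "UT_endomorphism m ?k'"
    using RR by (auto intro!: UT_conjugation)
  have kk: "?k (?k' a) = a" "?k' (?k a) = a" if "a \<in> carrier (UT m)" for a
    using UT_conjugation_inverse[of ?R' m ?R a] UT_conjugation_inverse[of ?R m ?R' a] RR that by simp_all
  have k_index: "?k a $$ (i, j) = \<rho> i * a $$ (i, j) * inverse (\<rho> j)"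
    if "a \<in> carrier (UT m)" "i < m" "j < m" for a i j
    using that UT_carrier_mat[of a m] UT_carrier_mat[of "?R * a" m] by (simp add: diagonal_mult_index)
  define \<phi> where "\<phi> a = \<psi>' (?k (\<chi> a))" for a
  define \<phi>' where "\<phi>' a = \<psi> (?k' (\<chi>' a))" for a
  have \<phi>: "UT_endomorphism m \<phi>" "UT_endomorphism m \<phi>'"
    unfolding \<phi>_def \<phi>'_def using A.\<psi> A.\<chi> B.\<psi> B.\<chi> k
    by (auto intro!: UT_endomorphism_comp[where f = \<psi>'] UT_endomorphism_comp[where f = \<psi>]
        UT_endomorphism_comp[where f = ?k] UT_endomorphism_comp[where f = ?k'])
  note \<phi>D = UT_endomorphismD[OF \<phi>(1)] and \<phi>'D = UT_endomorphismD[OF \<phi>(2)]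
  note kD = UT_endomorphismD[OF k(1)] and k'D = UT_endomorphismD[OF k(2)]
  have inv: "\<phi> (\<phi>' a) = a" "\<phi>' (\<phi> a) = a" if "a \<in> carrier (UT m)" for a
    unfolding \<phi>_def \<phi>'_def
    using that kk kD(1) k'D(1) by (simp_all add: A.\<chi>_\<psi> A.\<psi>_\<chi> B.\<chi>_\<psi> B.\<psi>_\<chi> A.\<chi>D(1) B.\<chi>D(1))
  have entry: "\<chi>' (\<phi> a) $$ (i, j) = \<rho> i * \<chi> a $$ (i, j) * inverse (\<rho> j)"
    if "a \<in> carrier (UT m)" "i < m" "j < m" for a i j
    unfolding \<phi>_def using that k_index[of "\<chi> a"] kD(1)[of "\<chi> a"] by (simp add: B.\<chi>_\<psi> A.\<chi>D(1))
  have "\<phi> \<in> ring_iso (UT m) (UT m)"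
  proof -
    have "bij_betw \<phi> (carrier (UT m)) (carrier (UT m))"
      by (rule bij_betw_byWitness[of _ \<phi>']) (use inv \<phi>D(1) \<phi>'D(1) in auto)
    then show ?thesis
      using \<phi>D by (auto simp: ring_iso_def ring_hom_def UT_simps(1,2,3))
  qed
  moreover have "linear_map (UT m) (UT m) \<phi>"
    using \<phi>D by (auto simp: linear_map_def UT_simps(2,5))
  moreover have "\<phi> a \<in> U' g" if a: "a \<in> U g" for a g
  proof (rule B.homogeneousI)
    have aC: "a \<in> carrier (UT m)" using A.U_UT[OF a] .
    then show "\<phi> a \<in> carrier (UT m)" using \<phi>D(1) by blast
    fix i j assume ij: "i \<le> j" "j < m" "\<chi>' (\<phi> a) $$ (i, j) \<noteq> 0"
    then have "\<chi> a $$ (i, j) \<noteq> 0" using entry[OF aC, of i j] by auto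
    then show "deg' i j = g"
      using A.entry_deg[OF a ij(1,2)] deg_eqI[OF A B deg ij(1,2)] by simp
  qed
  moreover have "\<phi> (s a) = s' (\<phi> a)" if a: "a \<in> carrier (UT m)" for a
  proof -
    \<comment> \<open>The coordinate map is injective, so the two sides are compared entry by entry
      through \<open>coordinate_star\<close>.\<close>
    have "\<chi>' (\<phi> (s a)) = \<chi>' (s' (\<phi> a))"
    proof (rule UT_eqI)
      show "\<chi>' (\<phi> (s a)) \<in> carrier (UT m)" "\<chi>' (s' (\<phi> a)) \<in> carrier (UT m)"
        using a by (simp_all add: B.\<chi>D(1) \<phi>D(1))
      fix p q assume pq: "q < m" "p \<le> q"
      let ?p = "m - 1 - p" and ?q = "m - 1 - q"
      have lt: "p < m" "?p < m" "?q < m" "?q \<le> ?p" using pq by auto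
      have "c 0 ?p = c 0 ?q * c ?q ?p" "c' 0 ?p = c' 0 ?q * c' ?q ?p"
        using A.star_coeff_mult[of 0 ?q ?p] B.star_coeff_mult[of 0 ?q ?p] lt by auto
      then have "\<nu> ?p * c ?q ?p = \<nu> ?q * c' ?q ?p"
        using nz[OF lt(2)] nz[OF lt(3)] by (simp add: \<nu>_def)
      then have "\<rho> p * \<rho> ?p * c ?q ?p = \<rho> q * \<rho> ?q * c' ?q ?p"
        using \<rho>(2)[of p] \<rho>(2)[of q] \<nu>_sym[of p] \<nu>_sym[of q] pq lt by simp
      then have "\<rho> p * c ?q ?p * inverse (\<rho> q) = c' ?q ?p * \<rho> ?q * inverse (\<rho> ?p)"
        using \<rho>(1)[of q] \<rho>(1)[of ?p] pq lt by (simp add: field_simps)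
      then have "\<rho> p * (c ?q ?p * x) * inverse (\<rho> q) = c' ?q ?p * (\<rho> ?q * x * inverse (\<rho> ?p))" for x
        by (simp add: mult_ac)
      then show "\<chi>' (\<phi> (s a)) $$ (p, q) = \<chi>' (s' (\<phi> a)) $$ (p, q)"
        using entry[of "s a" p q] entry[OF a lt(3,2)] a pq lt
          A.coordinate_star[OF a pq(2,1)] B.coordinate_star[of "\<phi> a", OF _ pq(2,1)] \<phi>D(1)[OF a] by simp
    qed
    then have "\<psi>' (\<chi>' (\<phi> (s a))) = \<psi>' (\<chi>' (s' (\<phi> a)))" by simp
    then show ?thesis using a by (simp add: B.\<psi>_\<chi> \<phi>D(1))
  qed
  ultimately show ?thesis
    unfolding graded_star_isomorphic_def by (intro exI[of _ \<phi>]) (simp add: image_subset_iff)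
qed

subsection \<open>Commutator polynomials\<close>

lemma poly_mapping_add_induct [case_names zero single add]:
  fixes f :: "'k \<Rightarrow>\<^sub>0 'b :: comm_monoid_add"
  assumes "P 0" "\<And>k x. P (Poly_Mapping.single k x)" "\<And>f g. P f \<Longrightarrow> P g \<Longrightarrow> P (f + g)"
  shows "P f"
proof (induction f rule: update_induct)
  case const
  then show ?case using assms(1) .
next
  case (update f k x)
  have "Poly_Mapping.update k x f = f + Poly_Mapping.single k x"
    using update.hyps
    by (intro poly_mapping_eqI) (auto simp: lookup_update lookup_add lookup_single in_keys_iff when_def)
  then show ?case using assms update.IH by simp
qed

text \<open>Isolates what makes evaluation an algebra homomorphism: all letters, starred or not,
  take values in \<open>UT m\<close>. The same lemmas then apply to both graded algebras.\<close>

locale UT_assignment =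
  fixes m :: nat and s :: "'f :: field mat \<Rightarrow> 'f mat" and a :: "nat \<Rightarrow> 'g :: ab_group_add \<Rightarrow> 'f mat"
  assumes assigned: "a i g \<in> carrier (UT m)" and star_assigned: "s (a i g) \<in> carrier (UT m)"
begin

abbreviation ev :: "('g, 'f) free_star_algebra \<Rightarrow> 'f mat" where
  "ev \<equiv> eval_poly (UT m) s a"

lemma eval_letter_UT [simp]: "eval_letter s a l \<in> carrier (UT m)"
  by (cases l) (auto simp: assigned star_assigned)

lemma eval_word_Nil: "eval_word (UT m) s a 0 = 1\<^sub>m m"
  by (simp add: eval_word_def zero_word_def UT_simps(3))

lemma eval_word_Cons:
  "eval_word (UT m) s a (Word (l # ls)) = eval_letter s a l * eval_word (UT m) s a (Word ls)"
  by (simp add: eval_word_def UT_simps(1))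

lemma eval_word_UT [simp]: "eval_word (UT m) s a w \<in> carrier (UT m)"
proof (cases w)
  case (Word ls)
  have "eval_word (UT m) s a (Word ls) \<in> carrier (UT m)"
    by (induction ls) (simp_all add: eval_word_Cons eval_word_Nil[unfolded zero_word_def])
  then show ?thesis using Word by simp
qed

lemma eval_word_plus: "eval_word (UT m) s a (v + w) = eval_word (UT m) s a v * eval_word (UT m) s a w"
proof (cases v, cases w)
  fix ls ks assume vw: "v = Word ls" "w = Word ks"
  have "eval_word (UT m) s a (Word (ls @ ks)) = eval_word (UT m) s a (Word ls) * eval_word (UT m) s a (Word ks)"
  proof (induction ls)
    case Nil
    then show ?case
      using UT_carrier_mat[OF eval_word_UT[of "Word ks"]] by (simp add: eval_word_Nil[unfolded zero_word_def])
  next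
    case (Cons l ls)
    then show ?case by (simp add: eval_word_Cons UT_assoc[where m = m])
  qed
  then show ?thesis using vw by (simp add: plus_word_def)
qed

text \<open>Evaluation sums over the support of \<open>f\<close>, which may shrink under addition
  through cancellation. Additivity therefore needs a common index set.\<close>

lemma eval_poly_superset:
  assumes "finite K" "Poly_Mapping.keys f \<subseteq> K"
  shows "ev f = finsum (UT m) (\<lambda>w. Poly_Mapping.lookup f w \<cdot>\<^sub>m eval_word (UT m) s a w) K"
proof -
  interpret abelian_monoid "UT m :: ('f, 'f mat) module" by (rule UT_abelian_monoid)
  show ?thesis
    unfolding eval_poly_def UT_simps(5)
    by (rule add.finprod_mono_neutral_cong_left)
      (use assms zero_smult_mat[OF UT_carrier_mat[OF eval_word_UT]]
        in \<open>auto simp: in_keys_iff UT_simps(4)\<close>)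
qed

lemma eval_poly_UT [simp]: "ev f \<in> carrier (UT m)"
proof -
  interpret abelian_monoid "UT m :: ('f, 'f mat) module" by (rule UT_abelian_monoid)
  show ?thesis unfolding eval_poly_def UT_simps(5) by (rule finsum_closed) auto
qed

lemma eval_poly_add: "ev (f + g) = ev f + ev g"
proof -
  interpret abelian_monoid "UT m :: ('f, 'f mat) module" by (rule UT_abelian_monoid)
  let ?K = "Poly_Mapping.keys f \<union> Poly_Mapping.keys g"
  let ?t = "\<lambda>f w. Poly_Mapping.lookup f w \<cdot>\<^sub>m eval_word (UT m) s a w"
  have "ev (f + g) = finsum (UT m) (?t (f + g)) ?K"
    by (rule eval_poly_superset) (use keys_add[of f g] in auto)
  also have "\<dots> = finsum (UT m) (\<lambda>w. ?t f w \<oplus>\<^bsub>UT m\<^esub> ?t g w) ?K"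
    using add_smult_distrib_right_mat[OF UT_carrier_mat[OF eval_word_UT]]
    by (simp add: lookup_add UT_simps(2))
  also have "\<dots> = finsum (UT m) (?t f) ?K \<oplus>\<^bsub>UT m\<^esub> finsum (UT m) (?t g) ?K"
    by (rule finsum_addf) auto
  also have "\<dots> = ev f + ev g"
    by (simp add: eval_poly_superset[of ?K f] eval_poly_superset[of ?K g] UT_simps(2))
  finally show ?thesis .
qed

lemma eval_poly_single: "ev (Poly_Mapping.single w x) = x \<cdot>\<^sub>m eval_word (UT m) s a w"
proof -
  interpret abelian_monoid "UT m :: ('f, 'f mat) module" by (rule UT_abelian_monoid)
  have "ev (Poly_Mapping.single w x)
      = finsum (UT m) (\<lambda>v. Poly_Mapping.lookup (Poly_Mapping.single w x) v \<cdot>\<^sub>m eval_word (UT m) s a v) {w}"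
    by (rule eval_poly_superset) auto
  then show ?thesis by simp
qed

lemma eval_poly_0: "ev 0 = 0\<^sub>m m m"
  using eval_poly_single[of 0 0] zero_smult_mat[OF UT_carrier_mat[OF eval_word_UT[of 0]]] by simp

lemma eval_poly_1: "ev 1 = 1\<^sub>m m"
  using eval_poly_single[of 0 1] by (simp add: eval_word_Nil)

lemma eval_poly_mult: "ev (f * g) = ev f * ev g"
proof (induction f rule: poly_mapping_add_induct)
  case zero
  then show ?case using UT_carrier_mat[OF eval_poly_UT[of g]] by (simp add: eval_poly_0)
next
  case (single k x)
  show ?case
  proof (induction g rule: poly_mapping_add_induct)
    case zero
    then show ?case using UT_carrier_mat[OF eval_poly_UT[of "Poly_Mapping.single k x"]] by (simp add: eval_poly_0)
  next
    case (single l y)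
    then show ?case
      by (simp add: mult_single eval_poly_single eval_word_plus UT_smult_mult[where m = m] smult_smult_mat mult.commute)
  next
    case (add f g)
    then show ?case by (simp add: distrib_left eval_poly_add UT_distrib[where m = m])
  qed
next
  case (add f f')
  then show ?case by (simp add: distrib_right eval_poly_add UT_distrib[where m = m])
qed

lemma eval_poly_minus: "ev (f - g) = ev f - ev g"
proof -
  have "ev f = ev (f - g) + ev g" using eval_poly_add[of "f - g" g] by simp
  then have "ev f - ev g = ev (f - g) + ev g - ev g" by simp
  also have "\<dots> = ev (f - g)"
    by (rule eq_matI) (simp_all add: UT_dims[OF eval_poly_UT])
  finally show ?thesis ..
qed

end

section \<open>Products of commutators and their values\<close>

definition monomial :: "'g letter list \<Rightarrow> ('g, 'f :: field) free_star_algebra" where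
  "monomial ls = Poly_Mapping.single (Word ls) 1"

text \<open>The second factor of the commutator has degree 0, so the commutator takes strictly upper
  triangular values of degree \<open>h\<close>, also when \<open>h = 0\<close>.\<close>

fun commutator_product :: "'g :: ab_group_add list \<Rightarrow> ('g, 'f :: field) free_star_algebra" where
  "commutator_product [] = 1"
| "commutator_product (h # hs) =
     (let n = length hs in
      monomial [Var (2 * n) h, Var (2 * n + 1) 0] - monomial [Var (2 * n + 1) 0, Var (2 * n) h]) *
     commutator_product hs"

text \<open>The formal adjoint of \<open>commutator_product\<close>: the factors are reversed and
  each [x, y] becomes [y*, x*]. Variables are numbered by the number of factors to the right, so
  different factors use different variables and a suffix of the list keeps its own.\<close>

fun commutator_product_star :: "'g :: ab_group_add list \<Rightarrow> ('g, 'f :: field) free_star_algebra" where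
  "commutator_product_star [] = 1"
| "commutator_product_star (h # hs) =
     commutator_product_star hs *
     (let n = length hs in
      monomial [StarVar (2 * n + 1) 0, StarVar (2 * n) h] - monomial [StarVar (2 * n) h, StarVar (2 * n + 1) 0])"

definition mat_commutator :: "'f :: field mat \<Rightarrow> 'f mat \<Rightarrow> 'f mat" where
  "mat_commutator x y = x * y - y * x"

fun commutator_value :: "nat \<Rightarrow> (nat \<Rightarrow> 'g :: ab_group_add \<Rightarrow> 'f :: field mat) \<Rightarrow> 'g list \<Rightarrow> 'f mat" where
  "commutator_value m a [] = 1\<^sub>m m"
| "commutator_value m a (h # hs) =
     mat_commutator (a (2 * length hs) h) (a (2 * length hs + 1) 0) * commutator_value m a hs"

lemma (in UT_assignment) eval_monomial:
  "ev (monomial [k, l]) = eval_letter s a k * eval_letter s a l"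
  using UT_carrier_mat[OF eval_letter_UT[of l]]
  by (simp add: monomial_def eval_poly_single eval_word_Cons eval_word_Nil[unfolded zero_word_def])

lemma mat_commutator_UT [simp]:
  "x \<in> carrier (UT m) \<Longrightarrow> y \<in> carrier (UT m) \<Longrightarrow> mat_commutator x y \<in> carrier (UT m)"
  by (simp add: mat_commutator_def)

lemma (in UT_assignment) commutator_value_UT [simp]: "commutator_value m a hs \<in> carrier (UT m)"
  by (induction hs) (simp_all add: assigned)

lemma (in UT_assignment) eval_commutator_product:
  "ev (commutator_product hs) = commutator_value m a hs"
  by (induction hs)
    (simp_all add: Let_def eval_poly_1 eval_poly_mult eval_poly_minus eval_monomial mat_commutator_def)

lemma (in UT_graded_star) star_one: "s (1\<^sub>m m) = 1\<^sub>m m"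
proof -
  have C: "s (1\<^sub>m m) \<in> carrier_mat m m" using UT_carrier_mat[OF star_UT] by simp
  have "s (1\<^sub>m m) = 1\<^sub>m m * s (1\<^sub>m m)" using C by simp
  also have "\<dots> = s (s (1\<^sub>m m)) * s (1\<^sub>m m)" by simp
  also have "\<dots> = s (1\<^sub>m m * s (1\<^sub>m m))" using star_mult[of "1\<^sub>m m" "s (1\<^sub>m m)"] by simp
  also have "\<dots> = 1\<^sub>m m" using C by simp
  finally show ?thesis .
qed

context UT_graded_star
begin

lemma assignment:
  assumes "\<And>i g. a i g \<in> U g" shows "UT_assignment m s a"
  using assms U_UT star_UT by unfold_locales blast+

lemma eval_commutator_product_star:
  assumes "\<And>i g. a i g \<in> U g"
  shows "eval_poly (UT m) s a (commutator_product_star hs) = s (commutator_value m a hs)"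
proof -
  interpret UT_assignment m s a by (rule assignment[OF assms])
  have *: "s (mat_commutator (a i g) (a j h)) = s (a j h) * s (a i g) - s (a i g) * s (a j h)" for i j g h
    using assigned by (simp add: mat_commutator_def star_minus star_mult)
  show ?thesis
    by (induction hs)
      (simp_all add: Let_def eval_poly_1 star_one eval_poly_mult eval_poly_minus eval_monomial * star_mult assigned)
qed

end

context UT_homogeneous_units
begin

lemma coordinate_minus:
  assumes "x \<in> carrier (UT m)" "y \<in> carrier (UT m)"
  shows "\<chi> (x - y) = \<chi> x - \<chi> y"
  using assms UT_minus_conv[OF assms] UT_minus_conv[OF \<chi>D(1)[OF assms(1)] \<chi>D(1)[OF assms(2)]]
  by (simp add: \<chi>D)

lemma coordinate_commutator:
  assumes "x \<in> carrier (UT m)" "y \<in> carrier (UT m)"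
  shows "\<chi> (mat_commutator x y) \<in> strip m 1"
  using assms strip_commutator[OF \<chi>D(1)[OF assms(1)] \<chi>D(1)[OF assms(2)]]
  by (simp add: mat_commutator_def coordinate_minus \<chi>D)

lemma commutator_value_strip:
  assumes "\<And>i g. a i g \<in> U g"
  shows "\<chi> (commutator_value m a hs) \<in> strip m (length hs)"
proof -
  interpret UT_assignment m s a by (rule assignment[OF assms])
  show ?thesis
  proof (induction hs)
    case Nil
    then show ?case by (simp add: \<chi>D(5) strip_0)
  next
    case (Cons h hs)
    from strip_mult[OF coordinate_commutator[OF assigned assigned] Cons.IH] show ?case
      by (simp add: \<chi>D(2) assigned)
  qed
qed

text \<open>The leading entry is the product of superdiagonal entries of the factors, so none of
  these is zero. Each factor is homogeneous of the prescribed degree, which must then be the degree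
  of the unit at that position. The row \<open>i\<close> is general because the induction moves down
  the superdiagonal.\<close>

lemma commutator_value_entry:
  assumes "\<And>i g. a i g \<in> U g" "i + length hs < m"
    and "\<chi> (commutator_value m a hs) $$ (i, i + length hs) \<noteq> 0" "k < length hs"
  shows "hs ! k = deg (i + k) (Suc (i + k))"
proof -
  interpret UT_assignment m s a by (rule assignment[OF assms(1)])
  show ?thesis
    using assms(2-4)
  proof (induction hs arbitrary: i k)
    case Nil
    then show ?case by simp
  next
    case (Cons h hs)
    let ?x = "mat_commutator (a (2 * length hs) h) (a (2 * length hs + 1) 0)"
    have "\<chi> (commutator_value m a (h # hs)) $$ (i, i + 1 + length hs)
        = \<chi> ?x $$ (i, i + 1) * \<chi> (commutator_value m a hs) $$ (i + 1, i + 1 + length hs)"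
      using strip_mult_entry[OF coordinate_commutator[OF assigned assigned] commutator_value_strip[OF assms(1)], of i]
        Cons.prems(1) by (simp add: \<chi>D(2) assigned)
    then have nz: "\<chi> ?x $$ (i, i + 1) \<noteq> 0"
      "\<chi> (commutator_value m a hs) $$ (i + 1, i + 1 + length hs) \<noteq> 0"
      using Cons.prems(2) by auto
    have "?x \<in> U h"
      unfolding mat_commutator_def using U_mult[OF assms(1) assms(1), of _ h _ 0] U_mult[OF assms(1) assms(1), of _ 0 _ h]
      by (intro U_minus) auto
    then have h: "deg i (Suc i) = h" using entry_deg nz(1) Cons.prems(1) by simp
    show ?case
    proof (cases k)
      case 0
      then show ?thesis using h by simp
    next
      case (Suc k')
      then show ?thesis using Cons.IH[of "i + 1" k'] Cons.prems nz(2) by simp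
    qed
  qed
qed

text \<open>The commutator of the units at \<open>(i, i + 1)\<close> and
  \<open>(i + 1, i + 1)\<close> is the former. Multiplying these along the superdiagonal yields the
  corner unit.\<close>

lemma commutator_value_nonzero:
  obtains a where "\<And>i g. a i g \<in> U g"
    "commutator_value m a (map (\<lambda>i. deg i (Suc i)) [0..<m - 1]) \<noteq> 0\<^sub>m m m"
proof -
  let ?F = "\<lambda>i j. \<psi> (mat_unit m i j)"
  \<comment> \<open>In a list of length \<open>m - 1\<close>, factor \<open>i\<close> has
    \<open>m - 2 - i\<close> factors to its right, which is \<open>n div 2\<close> for both of its
    variables. The guard \<open>Suc i < m\<close> excludes \<open>m = 1\<close>, where the product
    is empty.\<close>
  define a where "a n g =
    (let i = m - 2 - n div 2 in
     if Suc i < m \<and> even n \<and> g = deg i (Suc i) then ?F i (Suc i)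
     else if Suc i < m \<and> odd n \<and> g = 0 then ?F (Suc i) (Suc i) else 0\<^sub>m m m)" for n g
  have a: "a n g \<in> U g" for n g
    unfolding a_def Let_def using U_zero unit_deg by (auto simp: deg_diag[symmetric])
  interpret UT_assignment m s a by (rule assignment[OF a])
  have commutator: "mat_commutator (a (2 * (m - 2 - i)) (deg i (Suc i))) (a (2 * (m - 2 - i) + 1) 0) = ?F i (Suc i)"
    if "Suc i < m" for i
  proof -
    have "m - 2 - (m - 2 - i) = i" using that by linarith
    then have "a (2 * (m - 2 - i)) (deg i (Suc i)) = ?F i (Suc i)" "a (2 * (m - 2 - i) + 1) 0 = ?F (Suc i) (Suc i)"
      unfolding a_def Let_def using that by auto
    then show ?thesis using that by (auto simp: mat_commutator_def unit_mult intro!: eq_matI)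
  qed
  \<comment> \<open>The extra factor on the right accounts for the empty product, whose value is the
    identity and not a matrix unit.\<close>
  have "commutator_value m a (map (\<lambda>i. deg i (Suc i)) [i..<m - 1]) * ?F (m - 1) (m - 1) = ?F i (m - 1)"
    if "i \<le> m - 1" for i
    using that
  proof (induction i rule: inc_induct)
    case base
    then show ?case using UT_carrier_mat[OF unit_UT[of "m - 1" "m - 1"]] by simp
  next
    case (step i)
    have lt: "Suc i < m" using step.hyps by simp
    let ?V = "commutator_value m a (map (\<lambda>i. deg i (Suc i)) [Suc i..<m - 1])"
    have "[i..<m - 1] = i # [Suc i..<m - 1]" using step.hyps by (simp add: upt_conv_Cons)
    moreover have "length [Suc i..<m - 1] = m - 2 - i" by simp
    ultimately have "commutator_value m a (map (\<lambda>i. deg i (Suc i)) [i..<m - 1]) = ?F i (Suc i) * ?V"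
      using commutator[OF lt] by simp
    then show ?case
      using step.IH lt unit_mult[of i "Suc i" "Suc i" "m - 1"] by (simp add: UT_assoc[where m = m])
  qed
  from this[of 0] have "commutator_value m a (map (\<lambda>i. deg i (Suc i)) [0..<m - 1]) \<noteq> 0\<^sub>m m m"
    using unit_nonzero[of 0 "m - 1"] m_pos UT_carrier_mat[OF unit_UT[of "m - 1" "m - 1"]] by auto
  then show ?thesis using that a by blast
qed

end

subsection \<open>Identities and isomorphism\<close>

lemma UT_iso_zero:
  assumes "\<phi> \<in> ring_iso (UT m) (UT m')"
  shows "\<phi> (0\<^sub>m m m) = 0\<^sub>m m' m'"
proof -
  interpret ring_hom_ring "UT m" "UT m'" \<phi>
    using assms by (intro ring_hom_ringI2 UT_ring) (simp add: ring_iso_def)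
  show ?thesis using hom_zero by (simp add: UT_simps(4))
qed

lemma eval_poly_iso:
  assumes \<phi>: "\<phi> \<in> ring_iso (UT m) (UT m')" "linear_map (UT m) (UT m') \<phi>"
    and star: "\<And>x. x \<in> carrier (UT m) \<Longrightarrow> \<phi> (s x) = t (\<phi> x)"
    and A: "UT_assignment m s a" and B: "UT_assignment m' t (\<lambda>i g. \<phi> (a i g))"
  shows "\<phi> (eval_poly (UT m) s a f) = eval_poly (UT m') t (\<lambda>i g. \<phi> (a i g)) f"
proof -
  interpret A: UT_assignment m s a by fact
  interpret B: UT_assignment m' t "\<lambda>i g. \<phi> (a i g)" by fact
  have hom: "\<phi> (x * y) = \<phi> x * \<phi> y" "\<phi> (x + y) = \<phi> x + \<phi> y" "\<phi> (k \<cdot>\<^sub>m x) = k \<cdot>\<^sub>m \<phi> x" "\<phi> (1\<^sub>m m) = 1\<^sub>m m'"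
    if "x \<in> carrier (UT m)" "y \<in> carrier (UT m)" for x y k
    using \<phi> that by (auto simp: ring_iso_def ring_hom_def linear_map_def UT_simps(1,2,3,5))
  have letter: "\<phi> (eval_letter s a l) = eval_letter t (\<lambda>i g. \<phi> (a i g)) l" for l
    by (cases l) (simp_all add: star A.assigned)
  have word: "\<phi> (eval_word (UT m) s a w) = eval_word (UT m') t (\<lambda>i g. \<phi> (a i g)) w" for w
  proof (cases w)
    case (Word ls)
    have "\<phi> (eval_word (UT m) s a (Word ls)) = eval_word (UT m') t (\<lambda>i g. \<phi> (a i g)) (Word ls)"
    proof (induction ls)
      case Nil
      show ?case using hom(4)[of "1\<^sub>m m" "1\<^sub>m m"]
        by (simp add: A.eval_word_Nil[unfolded zero_word_def] B.eval_word_Nil[unfolded zero_word_def])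
    next
      case (Cons l ls)
      then show ?case by (simp add: A.eval_word_Cons B.eval_word_Cons hom letter)
    qed
    then show ?thesis using Word by simp
  qed
  show ?thesis
  proof (induction f rule: poly_mapping_add_induct)
    case zero
    show ?case using UT_iso_zero[OF \<phi>(1)] by (simp add: A.eval_poly_0 B.eval_poly_0)
  next
    case (single w x)
    show ?case
      using hom(3)[OF A.eval_word_UT A.eval_word_UT] by (simp add: A.eval_poly_single B.eval_poly_single word)
  next
    case (add f g)
    then show ?case by (simp add: A.eval_poly_add B.eval_poly_add hom)
  qed
qed

text \<open>An isomorphism commutes with evaluation. Identities pass forward because homogeneous
  values lift to homogeneous values of the same degree by \<open>graded_iso_image\<close>, and
  backward because the isomorphism is injective.\<close>

lemma isomorphic_imp_identities_eq:
  assumes A: "UT_graded_star m U s" and B: "UT_graded_star m' U' s'"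
    and iso: "graded_star_isomorphic (UT m) U s (UT m') U' s'"
  shows "star_identities (UT m) U s = star_identities (UT m') U' s'"
proof -
  interpret A: UT_graded_star m U s by fact
  interpret B: UT_graded_star m' U' s' by fact
  obtain \<phi> where \<phi>: "\<phi> \<in> ring_iso (UT m) (UT m')" "linear_map (UT m) (UT m') \<phi>"
    and graded: "\<And>g. \<phi> ` U g \<subseteq> U' g" and star: "\<And>x. x \<in> carrier (UT m) \<Longrightarrow> \<phi> (s x) = s' (\<phi> x)"
    using iso unfolding graded_star_isomorphic_def by blast
  have eval: "\<phi> (eval_poly (UT m) s a f) = eval_poly (UT m') s' (\<lambda>i g. \<phi> (a i g)) f"
    if "\<And>i g. a i g \<in> U g" for a f
  proof (rule eval_poly_iso[where s = s, OF \<phi>])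
    show "\<phi> (s x) = s' (\<phi> x)" if "x \<in> carrier (UT m)" for x using star[OF that] .
    show "UT_assignment m s a" by (rule A.assignment[OF that])
    show "UT_assignment m' s' (\<lambda>i g. \<phi> (a i g))"
      using that graded by (intro B.assignment) blast
  qed
  show ?thesis
  proof (intro equalityI subsetI)
    fix f assume f: "f \<in> star_identities (UT m) U s"
    have "eval_poly (UT m') s' b f = 0\<^sub>m m' m'" if b: "\<And>i g. b i g \<in> U' g" for b
    proof -
      have "b i g \<in> \<phi> ` U g" for i g
        using graded_iso_image[OF UT_abelian_monoid UT_abelian_monoid A.direct_sum B.direct_sum \<phi>(1) _ graded b]
          UT_iso_zero[OF \<phi>(1)] by (simp add: UT_simps(4))
      then have "\<forall>i g. \<exists>x. x \<in> U g \<and> b i g = \<phi> x" by blast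
      then obtain a where a: "\<And>i g. a i g \<in> U g" "\<And>i g. b i g = \<phi> (a i g)" by metis
      have "b = (\<lambda>i g. \<phi> (a i g))" using a(2) by blast
      then have "eval_poly (UT m') s' b f = \<phi> (eval_poly (UT m) s a f)" using eval[OF a(1)] by simp
      also have "eval_poly (UT m) s a f = 0\<^sub>m m m"
        using f a(1) by (simp add: star_identities_def UT_simps(4))
      finally show ?thesis using UT_iso_zero[OF \<phi>(1)] by simp
    qed
    then show "f \<in> star_identities (UT m') U' s'" by (simp add: star_identities_def UT_simps(4))
  next
    fix f assume f: "f \<in> star_identities (UT m') U' s'"
    have "eval_poly (UT m) s a f = 0\<^sub>m m m" if a: "\<And>i g. a i g \<in> U g" for a
    proof -
      interpret UT_assignment m s a by (rule A.assignment[OF a])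
      have "\<phi> (a i g) \<in> U' g" for i g using a graded by blast
      then have "\<phi> (ev f) = \<phi> (0\<^sub>m m m)"
        using f eval[OF a] UT_iso_zero[OF \<phi>(1)] by (simp add: star_identities_def UT_simps(4))
      moreover have "inj_on \<phi> (carrier (UT m))" using \<phi>(1) by (simp add: ring_iso_def bij_betw_def)
      ultimately show ?thesis by (meson UT_one_zero(2) eval_poly_UT inj_onD)
    qed
    then show "f \<in> star_identities (UT m) U s" by (simp add: star_identities_def UT_simps(4))
  qed
qed

context UT_homogeneous_units
begin

lemma commutator_product_identity_iff:
  "commutator_product hs \<in> star_identities (UT m) U s \<longleftrightarrow>
    (\<forall>a. (\<forall>i g. a i g \<in> U g) \<longrightarrow> commutator_value m a hs = 0\<^sub>m m m)"
proof -
  have "eval_poly (UT m) s a (commutator_product hs) = commutator_value m a hs"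
    if "\<forall>i g. a i g \<in> U g" for a
    using that by (intro UT_assignment.eval_commutator_product assignment) auto
  then show ?thesis by (auto simp: star_identities_def UT_simps(4))
qed

lemma commutator_value_top:
  assumes a: "\<And>i g. a i g \<in> U g" and hs: "length hs = m - 1"
  shows "commutator_value m a hs
    = \<chi> (commutator_value m a hs) $$ (0, m - 1) \<cdot>\<^sub>m \<psi> (mat_unit m 0 (m - 1))"
proof -
  interpret UT_assignment m s a by (rule assignment[OF a])
  let ?z = "commutator_value m a hs"
  have z: "\<chi> ?z \<in> strip m (m - 1)" using commutator_value_strip[where a = a and hs = hs, OF a] hs by simp
  have "\<chi> ?z = \<chi> ?z $$ (0, m - 1) \<cdot>\<^sub>m mat_unit m 0 (m - 1)"
  proof (rule strip_eqI[OF z])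
    show "\<chi> ?z $$ (0, m - 1) \<cdot>\<^sub>m mat_unit m 0 (m - 1) \<in> strip m (m - 1)"
      by (auto simp: strip_def)
    fix i j assume "j < m" "i + (m - 1) \<le> j"
    then have "i = 0" "j = m - 1" by auto
    then show "\<chi> ?z $$ (i, j) = (\<chi> ?z $$ (0, m - 1) \<cdot>\<^sub>m mat_unit m 0 (m - 1)) $$ (i, j)"
      using m_pos by simp
  qed
  then have "\<psi> (\<chi> ?z) = \<psi> (\<chi> ?z $$ (0, m - 1) \<cdot>\<^sub>m mat_unit m 0 (m - 1))" by simp
  then show ?thesis by (simp add: \<psi>_\<chi> \<psi>D(4))
qed

text \<open>Values of such products are multiples of the corner unit, and the position
  \<open>(0, m - 1)\<close> is its own reflection.\<close>

lemma star_commutator_value: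
  assumes a: "\<And>i g. a i g \<in> U g" and hs: "length hs = m - 1"
  shows "s (commutator_value m a hs) = c 0 (m - 1) \<cdot>\<^sub>m commutator_value m a hs"
proof -
  let ?F = "\<psi> (mat_unit m 0 (m - 1))" and ?x = "\<chi> (commutator_value m a hs) $$ (0, m - 1)"
  have "s (commutator_value m a hs) = s (?x \<cdot>\<^sub>m ?F)" using commutator_value_top[where a = a, OF a hs] by simp
  also have "\<dots> = c 0 (m - 1) \<cdot>\<^sub>m (?x \<cdot>\<^sub>m ?F)"
    using star_unit[of 0 "m - 1"] m_pos by (simp add: star_smult smult_smult_mat mult.commute)
  also have "?x \<cdot>\<^sub>m ?F = commutator_value m a hs" using commutator_value_top[where a = a, OF a hs] by simp
  finally show ?thesis .
qed

lemma commutator_value_degrees: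
  assumes a: "\<And>i g. a i g \<in> U g" and z: "commutator_value m a hs \<noteq> 0\<^sub>m m m"
  shows "length hs < m"
    and "length hs = m - 1 \<Longrightarrow> k < m - 1 \<Longrightarrow> hs ! k = deg k (Suc k)"
proof -
  interpret UT_assignment m s a by (rule assignment[OF a])
  have "\<chi> (commutator_value m a hs) \<noteq> 0\<^sub>m m m"
    using z \<psi>_\<chi>[of "commutator_value m a hs"] \<psi>D(6) by auto
  moreover have "\<chi> (commutator_value m a hs) = 0\<^sub>m m m" if "\<not> length hs < m"
    using commutator_value_strip[where a = a and hs = hs, OF a] that by (intro eq_matI) (auto simp: strip_def)
  ultimately show "length hs < m" by blast
  assume hs: "length hs = m - 1" and k: "k < m - 1"
  have "\<chi> (commutator_value m a hs) $$ (0, m - 1) \<noteq> 0"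
  proof
    assume "\<chi> (commutator_value m a hs) $$ (0, m - 1) = 0"
    then have "commutator_value m a hs = 0 \<cdot>\<^sub>m \<psi> (mat_unit m 0 (m - 1))"
      using commutator_value_top[where a = a, OF a hs] by simp
    then show False using z zero_smult_mat[OF UT_carrier_mat[OF unit_UT[of 0 "m - 1"]]] by simp
  qed
  then show "hs ! k = deg k (Suc k)"
    using commutator_value_entry[where a = a and i = 0 and hs = hs and k = k, OF a] hs k m_pos by simp
qed

end

text \<open>The product built from the degrees of the second algebra is not an identity there, hence
  not in the first. A nonzero value in the first algebra bounds the length \<open>m' - 1\<close>
  and, when the sizes agree, forces the degrees to match. One inclusion bounds only one size, so
  both are used to obtain equality.\<close>

lemma identities_determine_degrees:
  assumes A: "UT_homogeneous_units m U s \<psi> \<chi> deg c"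
    and B: "UT_homogeneous_units m' U' s' \<psi>' \<chi>' deg' c'"
    and sub: "star_identities (UT m) U s \<subseteq> star_identities (UT m') U' s'"
  shows "m' \<le> m" and "m' = m \<Longrightarrow> Suc i < m \<Longrightarrow> deg i (Suc i) = deg' i (Suc i)"
proof -
  interpret A: UT_homogeneous_units m U s \<psi> \<chi> deg c by fact
  interpret B: UT_homogeneous_units m' U' s' \<psi>' \<chi>' deg' c' by fact
  let ?hs = "map (\<lambda>i. deg' i (Suc i)) [0..<m' - 1]"
  obtain b where "\<And>i g. b i g \<in> U' g" "commutator_value m' b ?hs \<noteq> 0\<^sub>m m' m'"
    using B.commutator_value_nonzero by blast
  then have "commutator_product ?hs \<notin> star_identities (UT m') U' s'"
    using B.commutator_product_identity_iff by blast
  then have "commutator_product ?hs \<notin> star_identities (UT m) U s" using sub by blast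
  then obtain a where a: "\<And>i g. a i g \<in> U g" "commutator_value m a ?hs \<noteq> 0\<^sub>m m m"
    using A.commutator_product_identity_iff by blast
  show "m' \<le> m" using A.commutator_value_degrees(1)[OF a] by simp
  assume "m' = m" "Suc i < m"
  then show "deg i (Suc i) = deg' i (Suc i)"
    using A.commutator_value_degrees(2)[OF a, of i] by simp
qed

text \<open>On the values of a product of \<open>m - 1\<close> commutators the involution is multiplication by the
  sign \<open>c 0 (m - 1)\<close>.\<close>

lemma identities_determine_sign:
  assumes A: "UT_homogeneous_units m U s \<psi> \<chi> deg c"
    and B: "UT_homogeneous_units m U' s' \<psi>' \<chi>' deg' c'"
    and sub: "star_identities (UT m) U s \<subseteq> star_identities (UT m) U' s'"
  shows "c 0 (m - 1) = c' 0 (m - 1)"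
proof -
  interpret A: UT_homogeneous_units m U s \<psi> \<chi> deg c by fact
  interpret B: UT_homogeneous_units m U' s' \<psi>' \<chi>' deg' c' by fact
  let ?hs = "map (\<lambda>i. deg' i (Suc i)) [0..<m - 1]"
  let ?\<epsilon> = "c 0 (m - 1)"
  \<comment> \<open>On a commutator value z this gives z - \<epsilon> z*. In the first algebra z* =
    \<epsilon> z and \<epsilon> has square 1, so the polynomial is an identity. In the second, where
    z can be chosen nonzero, it gives (1 - \<epsilon> \<epsilon>') z and forces \<epsilon>
    \<epsilon>' = 1.\<close>
  let ?p = "commutator_product ?hs - Poly_Mapping.single 0 ?\<epsilon> * commutator_product_star ?hs"
  have len: "length ?hs = m - 1" by simp
  have \<epsilon>: "?\<epsilon> * ?\<epsilon> = 1" using A.star_coeff_reflect[of 0 "m - 1"] A.m_pos by simp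
  have ev: "eval_poly (UT m) t a ?p = commutator_value m a ?hs - ?\<epsilon> \<cdot>\<^sub>m t (commutator_value m a ?hs)"
    if X: "UT_graded_star m V t" and a: "\<And>i g. a i g \<in> V g" for V t a
  proof -
    interpret X: UT_graded_star m V t by fact
    interpret UT_assignment m t a by (rule X.assignment[OF a])
    have "1\<^sub>m m * t (commutator_value m a ?hs) = t (commutator_value m a ?hs)"
      using UT_carrier_mat[OF X.star_UT[OF commutator_value_UT]] by (rule left_mult_one_mat)
    then show ?thesis
      by (simp add: eval_poly_minus eval_poly_mult eval_poly_single eval_word_Nil eval_commutator_product
          X.eval_commutator_product_star[OF a] UT_smult_mult[where m = m])
  qed
  have "eval_poly (UT m) s a ?p = 0\<^sub>m m m" if a: "\<And>i g. a i g \<in> U g" for a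
  proof -
    interpret UT_assignment m s a by (rule A.assignment[OF a])
    show ?thesis
      unfolding ev[OF A.UT_graded_star_axioms a] A.star_commutator_value[OF a len] smult_smult_mat \<epsilon>
      using UT_carrier_mat[OF commutator_value_UT] by (simp add: minus_r_inv_mat)
  qed
  then have p: "?p \<in> star_identities (UT m) U' s'"
    using sub by (auto simp: star_identities_def UT_simps(4))
  obtain b where b: "\<And>i g. b i g \<in> U' g" "commutator_value m b ?hs \<noteq> 0\<^sub>m m m"
    using B.commutator_value_nonzero by blast
  interpret UT_assignment m s' b by (rule B.assignment[OF b(1)])
  let ?z = "commutator_value m b ?hs"
  have zC: "?z \<in> carrier_mat m m" using UT_carrier_mat[OF commutator_value_UT] .
  have "?z - (?\<epsilon> * c' 0 (m - 1)) \<cdot>\<^sub>m ?z = 0\<^sub>m m m"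
    using ev[OF B.UT_graded_star_axioms b(1)] p b(1) B.star_commutator_value[OF b(1) len]
    by (simp add: star_identities_def UT_simps(4) smult_smult_mat)
  moreover have "?z - (?\<epsilon> * c' 0 (m - 1)) \<cdot>\<^sub>m ?z = (1 - ?\<epsilon> * c' 0 (m - 1)) \<cdot>\<^sub>m ?z"
    by (rule eq_matI) (use zC in \<open>auto simp: algebra_simps\<close>)
  ultimately have "(1 - ?\<epsilon> * c' 0 (m - 1)) \<cdot>\<^sub>m ?z = 0 \<cdot>\<^sub>m ?z"
    using zero_smult_mat[OF zC] by simp
  then have "?\<epsilon> * c' 0 (m - 1) = 1" using smult_mat_cancel[OF zC b(2)] by fastforce
  then have "?\<epsilon> * (?\<epsilon> * c' 0 (m - 1)) = ?\<epsilon>" by (simp only: mult_1_right)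
  then show ?thesis by (simp only: \<epsilon> mult_1_left flip: mult.assoc)
qed

theorem proposition1p5:
  fixes \<U> :: "'g :: ab_group_add \<Rightarrow> 'f :: alg_closed_field mat set"
    and \<U>' :: "'g \<Rightarrow> 'f mat set"
    and circ diam :: "'f mat \<Rightarrow> 'f mat"
    and m m' :: nat
  assumes "CHAR('f) \<noteq> 2"
    and "m > 0" and "m' > 0"
    and "grading (UT m) \<U>" and "grading (UT m') \<U>'"
    and "graded_involution (UT m) \<U> circ" and "graded_involution (UT m') \<U>' diam"
  shows "graded_star_isomorphic (UT m) \<U> circ (UT m') \<U>' diam \<longleftrightarrow>
         star_identities (UT m) \<U> circ = star_identities (UT m') \<U>' diam"
proof
  have A: "UT_graded_star m \<U> circ" and B: "UT_graded_star m' \<U>' diam"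
    using assms by unfold_locales
  show "star_identities (UT m) \<U> circ = star_identities (UT m') \<U>' diam"
    if "graded_star_isomorphic (UT m) \<U> circ (UT m') \<U>' diam"
    using isomorphic_imp_identities_eq[OF A B that] .
  assume eq: "star_identities (UT m) \<U> circ = star_identities (UT m') \<U>' diam"
  \<comment> \<open>If 2 were zero in the field, the characteristic would divide 2, leaving only 1
    and 2 to exclude.\<close>
  have "CHAR('f) \<noteq> 1" by (metis of_nat_1 of_nat_CHAR zero_neq_one)
  have two: "(2 :: 'f) \<noteq> 0"
  proof
    assume "(2 :: 'f) = 0"
    then have "of_nat 2 = (0 :: 'f)" by simp
    then have "CHAR('f) dvd 2" by (simp only: of_nat_eq_0_iff_char_dvd)
    then show False using assms(1) \<open>CHAR('f) \<noteq> 1\<close> two_is_prime_nat prime_nat_iff by blast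
  qed
  obtain \<psi> \<chi> deg c where A': "UT_homogeneous_units m \<U> circ \<psi> \<chi> deg c"
    using UT_graded_star.homogeneous_units_exist[OF A two] by blast
  obtain \<psi>' \<chi>' deg' c' where B': "UT_homogeneous_units m' \<U>' diam \<psi>' \<chi>' deg' c'"
    using UT_graded_star.homogeneous_units_exist[OF B two] by blast
  have m: "m' = m"
    using identities_determine_degrees(1)[OF A' B'] identities_determine_degrees(1)[OF B' A'] eq by simp
  note B' = B'[unfolded m] and sub = equalityD1[OF eq[unfolded m]]
  show "graded_star_isomorphic (UT m) \<U> circ (UT m') \<U>' diam"
    unfolding m
    by (rule homogeneous_units_isomorphic[OF A' B'
          identities_determine_degrees(2)[OF A' B' sub refl] identities_determine_sign[OF A' B' sub]])
qed

end
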